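(* Every connected graph $G$ has a rooted tree-decomposition $(T,\mathcal{V})$ of finite adhesion, all of whose parts induce connected subgraphs of $G$, which has upwards disjoint separators and displays the set of all topological ends of $G$.
   Context: Ends: a ray is a one-way infinite path; two rays in $G$ are equivalent if no finite vertex set separates them; equivalence classes are the ends (the same definition applies to the tree $T$, giving the ends of $T$). A vertex $v$ dominates an end $\varepsilon$ if there is a subdivided infinite star with centre $v$ all of whose leaves lie on a ray of $\varepsilon$; an end is topological if it is not dominated by any vertex. A tree-decomposition of $G$ is a pair $(T,\mathcal{V})$ with $T$ a tree and $\mathcal{V}=(V_t : t\in T)$ vertex sets of $G$ (parts) such that every vertex lies in some part, every edge has both ends in some part, and $V_{t_1}\cap V_{t_3}\subseteq V_{t_2}$ whenever $t_2$ lies on the $t_1$–$t_3$ path in $T$. For an edge $e=xy$ of $T$, let $T_x,T_y$ be the components of $T-e$ containing $x,y$, $A_x=\bigcup_{t\in T_x}V_t$, $A_y=\bigcup_{t\in T_y}V_t$, and $X_e=V_x\cap V_y$ the separator induced by $e$. The decomposition has finite adhesion if every $X_e$ is finite. In that case every end $\varepsilon$ of $G$ orients each edge $e=xy$ towards $x$ or $y$ according to whether $\varepsilon$ lives (has a tail of each of its rays) in a component of $G[A_x]-X_e$ or of $G[A_y]-X_e$; this orientation points either towards a node of $T$ or towards an end of $T$, and $\varepsilon$ is said to live in that part or in that end of $T$, respectively. The decomposition displays a set $\Psi$ of ends of $G$ if in every end of $T$ there lives exactly one end of $G$ and it belongs to $\Psi$, and every end in $\Psi$ lives in some end of $T$.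 A rooted tree-decomposition is one with $T$ rooted; it has upwards disjoint separators if $X_e\cap X_{e'}=\emptyset$ for any two distinct edges $e<e'$ comparable in the tree order of $T$. *)

theory Defs
  imports "Graph_Theory.Graph_Theory"
begin

text \<open>
  A simple graph of arbitrary cardinality is a \<^typ>\<open>'a pair_pre_digraph\<close> satisfying
  \<^locale>\<open>pair_bidirected_digraph\<close>: each undirected edge is represented by its two arcs,
  and there are no loops.  In \<open>Graph_Theory\<close>, \<^const>\<open>connected\<close> graphs are
  non-empty, and \<open>u \<rightarrow>\<^bsub>G\<^esub> v\<close> (\<open>dominates\<close> there) is just adjacency;
  it has nothing to do with a vertex dominating an end.
\<close>

section \<open>Ends\<close>

text \<open>A ray is given by its vertices in their order along the ray.\<close>

definition ray :: "'a pair_pre_digraph \<Rightarrow> (nat \<Rightarrow> 'a) \<Rightarrow> bool" where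
  "ray G r \<longleftrightarrow> inj r \<and> (\<forall>n. r n \<rightarrow>\<^bsub>with_proj G\<^esub> r (Suc n))"

text \<open>\<open>X\<close> separates \<open>A\<close> from \<open>B\<close>: every path in \<open>G\<close> from \<open>A\<close> to \<open>B\<close> meets \<open>X\<close>.\<close>

definition separates :: "'a pair_pre_digraph \<Rightarrow> 'a set \<Rightarrow> 'a set \<Rightarrow> 'a set \<Rightarrow> bool" where
  "separates G X A B \<longleftrightarrow>
     (\<forall>a\<in>A. \<forall>b\<in>B. \<not> a \<rightarrow>\<^sup>*\<^bsub>with_proj G \<restriction> (pverts G - X)\<^esub> b)"

definition equivalent_rays :: "'a pair_pre_digraph \<Rightarrow> (nat \<Rightarrow> 'a) \<Rightarrow> (nat \<Rightarrow> 'a) \<Rightarrow> bool" where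
  "equivalent_rays G r s \<longleftrightarrow>
     \<not> (\<exists>X\<subseteq>pverts G. finite X \<and> separates G X (range r) (range s))"

definition ends :: "'a pair_pre_digraph \<Rightarrow> (nat \<Rightarrow> 'a) set set" where
  "ends G = {r. ray G r} // {(r, s). ray G r \<and> ray G s \<and> equivalent_rays G r s}"

definition has_tail_in :: "(nat \<Rightarrow> 'a) \<Rightarrow> 'a set \<Rightarrow> bool" where
  "has_tail_in r C \<longleftrightarrow> (\<exists>n. \<forall>m\<ge>n. r m \<in> C)"

text \<open>
  A subdivided infinite star with centre \<open>v\<close>: the paths \<open>P n\<close> are the subdivided edges,
  each leading from \<open>v\<close> to the leaf \<open>last (P n)\<close>.  Countably many paths suffice, since in
  the definition of domination all leaves lie on one ray.
\<close>

definition subdivided_star :: "'a pair_pre_digraph \<Rightarrow> 'a \<Rightarrow> (nat \<Rightarrow> 'a list) \<Rightarrow> bool" where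
  "subdivided_star G v P \<longleftrightarrow>
     (\<forall>n. vpath (P n) (with_proj G) \<and> hd (P n) = v \<and> last (P n) \<noteq> v) \<and>
     (\<forall>m n. m \<noteq> n \<longrightarrow> set (P m) \<inter> set (P n) = {v})"

definition dominates_end :: "'a pair_pre_digraph \<Rightarrow> 'a \<Rightarrow> (nat \<Rightarrow> 'a) set \<Rightarrow> bool" where
  "dominates_end G v \<epsilon> \<longleftrightarrow>
     (\<exists>P. subdivided_star G v P \<and> (\<exists>r\<in>\<epsilon>. \<forall>n. last (P n) \<in> range r))"

definition topological_ends :: "'a pair_pre_digraph \<Rightarrow> (nat \<Rightarrow> 'a) set set" where
  "topological_ends G = {\<epsilon> \<in> ends G. \<not> (\<exists>v\<in>pverts G. dominates_end G v \<epsilon>)}"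

section \<open>Tree-decompositions\<close>

text \<open>
  The library's \<^const>\<open>tree\<close> cannot be used for undirected graphs, because an edge traversed
  back and forth is a \<open>cycle\<close> of length 2 there.  The cycles of an undirected simple graph
  are those of length at least 3.
\<close>

definition undirected_tree :: "'t pair_pre_digraph \<Rightarrow> bool" where
  "undirected_tree T \<longleftrightarrow>
     pair_bidirected_digraph T \<and> connected (with_proj T) \<and>
     \<not> (\<exists>p. pre_digraph.cycle (with_proj T) p \<and> length p \<ge> 3)"

definition on_path :: "'t pair_pre_digraph \<Rightarrow> 't \<Rightarrow> 't \<Rightarrow> 't \<Rightarrow> bool" where
  "on_path T s t u \<longleftrightarrow>
     (\<exists>p. vpath p (with_proj T) \<and> hd p = s \<and> last p = u \<and> t \<in> set p)"

definition tree_decomposition ::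
    "'a pair_pre_digraph \<Rightarrow> 't pair_pre_digraph \<Rightarrow> ('t \<Rightarrow> 'a set) \<Rightarrow> bool" where
  "tree_decomposition G T V \<longleftrightarrow>
     undirected_tree T \<and>
     (\<forall>t\<in>pverts T. V t \<subseteq> pverts G) \<and>
     (\<forall>v\<in>pverts G. \<exists>t\<in>pverts T. v \<in> V t) \<and>
     (\<forall>u v. u \<rightarrow>\<^bsub>with_proj G\<^esub> v \<longrightarrow> (\<exists>t\<in>pverts T. u \<in> V t \<and> v \<in> V t)) \<and>
     (\<forall>t\<^sub>1 t\<^sub>2 t\<^sub>3. on_path T t\<^sub>1 t\<^sub>2 t\<^sub>3 \<longrightarrow> V t\<^sub>1 \<inter> V t\<^sub>3 \<subseteq> V t\<^sub>2)"

text \<open>For an edge \<open>xy\<close> of \<open>T\<close>: the separator, the node set of the component of \<open>T - xy\<close>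
  containing \<open>x\<close>, and the union of its parts.\<close>

definition separator :: "('t \<Rightarrow> 'a set) \<Rightarrow> 't \<Rightarrow> 't \<Rightarrow> 'a set" where
  "separator V x y = V x \<inter> V y"

definition tree_side :: "'t pair_pre_digraph \<Rightarrow> 't \<Rightarrow> 't \<Rightarrow> 't set" where
  "tree_side T x y =
     {t. x \<rightarrow>\<^sup>*\<^bsub>with_proj \<lparr>pverts = pverts T, parcs = parcs T - {(x, y), (y, x)}\<rparr>\<^esub> t}"

definition side :: "'t pair_pre_digraph \<Rightarrow> ('t \<Rightarrow> 'a set) \<Rightarrow> 't \<Rightarrow> 't \<Rightarrow> 'a set" where
  "side T V x y = (\<Union>t\<in>tree_side T x y. V t)"

definition finite_adhesion :: "'t pair_pre_digraph \<Rightarrow> ('t \<Rightarrow> 'a set) \<Rightarrow> bool" where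
  "finite_adhesion T V \<longleftrightarrow> (\<forall>x y. x \<rightarrow>\<^bsub>with_proj T\<^esub> y \<longrightarrow> finite (separator V x y))"

text \<open>The end \<open>\<epsilon>\<close> orients the edge \<open>xy\<close> of \<open>T\<close> towards \<open>x\<close>.  For symmetric graphs,
  \<^const>\<open>pre_digraph.sccs_verts\<close> are the vertex sets of the components.\<close>

definition orients_towards ::
    "'a pair_pre_digraph \<Rightarrow> 't pair_pre_digraph \<Rightarrow> ('t \<Rightarrow> 'a set) \<Rightarrow> (nat \<Rightarrow> 'a) set \<Rightarrow> 't \<Rightarrow> 't \<Rightarrow> bool"
where
  "orients_towards G T V \<epsilon> x y \<longleftrightarrow>
     (\<exists>C \<in> pre_digraph.sccs_verts (with_proj G \<restriction> (side T V x y - separator V x y)).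
        \<forall>r\<in>\<epsilon>. has_tail_in r C)"

text \<open>
  The orientation induced by \<open>\<epsilon>\<close> points towards the end \<open>\<omega>\<close> of \<open>T\<close>: every edge of \<open>T\<close> is
  oriented towards the side in which the rays of \<open>\<omega>\<close> have tails.
\<close>

definition lives_in_tree_end ::
    "'a pair_pre_digraph \<Rightarrow> 't pair_pre_digraph \<Rightarrow> ('t \<Rightarrow> 'a set) \<Rightarrow>
     (nat \<Rightarrow> 'a) set \<Rightarrow> (nat \<Rightarrow> 't) set \<Rightarrow> bool" where
  "lives_in_tree_end G T V \<epsilon> \<omega> \<longleftrightarrow>
     (\<forall>x y. x \<rightarrow>\<^bsub>with_proj T\<^esub> y \<and> (\<forall>\<rho>\<in>\<omega>. has_tail_in \<rho> (tree_side T x y)) \<longrightarrow>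
        orients_towards G T V \<epsilon> x y)"

definition displays ::
    "'a pair_pre_digraph \<Rightarrow> 't pair_pre_digraph \<Rightarrow> ('t \<Rightarrow> 'a set) \<Rightarrow> (nat \<Rightarrow> 'a) set set \<Rightarrow> bool"
where
  "displays G T V \<Psi> \<longleftrightarrow>
     (\<forall>\<omega>\<in>ends T. (\<exists>!\<epsilon>. \<epsilon> \<in> ends G \<and> lives_in_tree_end G T V \<epsilon> \<omega>) \<and>
                 (\<forall>\<epsilon>\<in>ends G. lives_in_tree_end G T V \<epsilon> \<omega> \<longrightarrow> \<epsilon> \<in> \<Psi>)) \<and>
     (\<forall>\<epsilon>\<in>\<Psi>. \<exists>\<omega>\<in>ends T. lives_in_tree_end G T V \<epsilon> \<omega>)"

section \<open>Rooted tree-decompositions\<close>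

definition rooted_tree_decomposition ::
    "'a pair_pre_digraph \<Rightarrow> 't pair_pre_digraph \<Rightarrow> 't \<Rightarrow> ('t \<Rightarrow> 'a set) \<Rightarrow> bool" where
  "rooted_tree_decomposition G T z V \<longleftrightarrow> tree_decomposition G T V \<and> z \<in> pverts T"

definition tree_le :: "'t pair_pre_digraph \<Rightarrow> 't \<Rightarrow> 't \<Rightarrow> 't \<Rightarrow> bool" where
  "tree_le T z s t \<longleftrightarrow> on_path T z s t"

text \<open>
  An edge is named by its arc \<open>(x, y)\<close> pointing away from the root \<open>z\<close>.  For such arcs, the
  edge \<open>xy\<close> lies strictly below the edge \<open>x'y'\<close> in the tree order iff \<open>y \<le> x'\<close>.
\<close>

definition upward_arc :: "'t pair_pre_digraph \<Rightarrow> 't \<Rightarrow> 't \<Rightarrow> 't \<Rightarrow> bool" where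
  "upward_arc T z x y \<longleftrightarrow> x \<rightarrow>\<^bsub>with_proj T\<^esub> y \<and> tree_le T z x y"

definition upwards_disjoint_separators ::
    "'t pair_pre_digraph \<Rightarrow> 't \<Rightarrow> ('t \<Rightarrow> 'a set) \<Rightarrow> bool" where
  "upwards_disjoint_separators T z V \<longleftrightarrow>
     (\<forall>x y x' y'. upward_arc T z x y \<and> upward_arc T z x' y' \<and> tree_le T z y x' \<longrightarrow>
        separator V x y \<inter> separator V x' y' = {})"

text \<open>
  On the node type used in the theorem: HOL cannot quantify existentially over types, so the
  nodes of \<open>T\<close> are taken from \<^typ>\<open>'a set list\<close>, where \<^typ>\<open>'a\<close> is the vertex type.  This
  loses no generality.  Given a rooted tree-decomposition with the properties asserted, delete,
  for every node \<open>t\<close> and child \<open>c\<close> of \<open>t\<close>, the subtree above \<open>c\<close> if its parts are all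
  contained in \<open>V t\<close>; such a subtree contains no end of \<open>T\<close>, and all properties are preserved.
  Then every node has at most as many children as \<open>G\<close> has vertices, so the number of nodes is
  at most countable or at most the number of vertices.
\<close>

end

theory Submission
  imports Defs "HOL-Library.Sublist"
begin

text \<open>
  The tree-decomposition is built recursively from the root.  Given a region \<open>D\<close> with finite
  non-empty boundary \<open>X\<close>, choose a connected part \<open>W\<close> that contains \<open>X\<close> and all neighbours of \<open>X\<close>,
  such that every component of the rest has a finite neighbourhood and every ray not dominated by
  a vertex of \<open>X\<close> has a tail in such a component.  The components are the regions of the children.
  Since neighbours of \<open>X\<close> lie in \<open>W\<close>, separators along a branch are disjoint; hence the regions along
  an infinite branch are nested with empty intersection, and exactly one end, necessarily
  undominated, lives there.  Conversely an undominated end never stays in a part.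

  To find \<open>W\<close>, let \<open>U\<close> be \<open>X\<close> with its neighbours.  Add a maximal family of disjoint rays with end
  in the closure of \<open>U\<close>, and then all vertices that cannot be separated finitely from the result.
  Neither step adds ends to the closure, and by a star-comb argument the components of the rest have
  finite neighbourhoods.  Finally add finite connected sets to make the part connected.  An end in
  the closure of \<open>U\<close> is dominated by a vertex of the finite set \<open>X\<close>.
\<close>

section \<open>Connectivity in induced subgraphs\<close>

text \<open>That the nested regions exhaust the graph rests on a measure. A walk from a vertex of a
  child region \<open>D\<close> to the boundary of its parent must leave \<open>D\<close> through
  the neighbourhood of \<open>D\<close>. This neighbourhood is disjoint from that boundary, so it is
  met strictly before the walk ends. Hence the distance to the boundary drops with every level, and
  each vertex lies in a part after finitely many levels. Each part is chosen inside a region with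
  its boundary, not in the whole graph. This does no harm: the neighbourhoods of the components are
  the same in both, and a vertex that dominates a ray in the smaller graph dominates it in
  \<open>G\<close>. Finiteness of \<open>X\<close> is what turns closure into domination. If every
  vertex of \<open>X\<close> were separated from the ray by some finite set, the union of these sets
  with \<open>X\<close> would be finite and would separate the ray from all of \<open>U\<close>. The
  family of disjoint rays comes from Zorn's lemma, so no bound on the cardinality of the graph
  enters.\<close>

locale sym_rel =
  fixes E :: "'a \<Rightarrow> 'a \<Rightarrow> bool"
  assumes E_sym: "E x y \<Longrightarrow> E y x"
begin

text \<open>The conjunct \<open>a \<in> B\<close> is there because \<open>rtranclp\<close> is
  reflexive everywhere; with it, \<open>conn B\<close> is an equivalence relation on
  \<open>B\<close> and false outside \<open>B\<close>.\<close>

definition conn :: "'a set \<Rightarrow> 'a \<Rightarrow> 'a \<Rightarrow> bool" where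
  "conn B a b \<longleftrightarrow> a \<in> B \<and> (\<lambda>x y. E x y \<and> x \<in> B \<and> y \<in> B)\<^sup>*\<^sup>* a b"

definition connd :: "'a set \<Rightarrow> bool" where
  "connd B \<longleftrightarrow> (\<forall>a\<in>B. \<forall>b\<in>B. conn B a b)"

definition nb :: "'a set \<Rightarrow> 'a set \<Rightarrow> 'a set" where
  "nb B D = {y \<in> B - D. \<exists>x\<in>D. E x y}"

definition comps :: "'a set \<Rightarrow> 'a set set" where
  "comps B = (\<lambda>a. {b. conn B a b}) ` B"

lemma conn_refl: "a \<in> B \<Longrightarrow> conn B a a"
  by (simp add: conn_def)

lemma conn_in: assumes "conn B a b" shows "a \<in> B" "b \<in> B"
proof -
  show "a \<in> B" using assms by (simp add: conn_def)
  have "(\<lambda>x y. E x y \<and> x \<in> B \<and> y \<in> B)\<^sup>*\<^sup>* a b" using assms by (simp add: conn_def)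
  then show "b \<in> B" by (induction rule: rtranclp_induct) (use \<open>a \<in> B\<close> in auto)
qed

lemma conn_trans: "conn B a b \<Longrightarrow> conn B b c \<Longrightarrow> conn B a c"
  unfolding conn_def by (auto intro: rtranclp_trans)

lemma conn_step: "E a b \<Longrightarrow> a \<in> B \<Longrightarrow> b \<in> B \<Longrightarrow> conn B a b"
  unfolding conn_def by (auto intro: r_into_rtranclp)

lemma conn_induct [consumes 1, case_names base step]:
  assumes "conn B a b" "P a"
    and "\<And>x y. \<lbrakk>conn B a x; E x y; x \<in> B; y \<in> B; P x\<rbrakk> \<Longrightarrow> P y"
  shows "P b"
proof -
  have a: "a \<in> B" and "(\<lambda>x y. E x y \<and> x \<in> B \<and> y \<in> B)\<^sup>*\<^sup>* a b" using assms(1) by (auto simp: conn_def)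
  from this(2) show ?thesis
    by (induction rule: rtranclp_induct) (use a assms(2,3) in \<open>auto simp: conn_def\<close>)
qed

lemma conn_sym: assumes "conn B a b" shows "conn B b a"
  using assms
proof (induction rule: conn_induct)
  case base show ?case using assms by (rule conn_refl[OF conn_in(1)])
next
  case (step x y) then show ?case by (meson E_sym conn_step conn_trans)
qed

lemma conn_mono: assumes "conn B a b" "B \<subseteq> B'" shows "conn B' a b"
  using assms(1)
proof (induction rule: conn_induct)
  case base show ?case using assms conn_refl conn_in(1) by blast
next
  case (step x y) then show ?case using assms(2) by (meson conn_step conn_trans subsetD)
qed

lemma conn_leave:
  assumes "conn B a b" "a \<in> D" "b \<notin> D"
  obtains x y where "conn (B \<inter> D) a x" "x \<in> D" "y \<in> B - D" "E x y"
proof -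
  have "b \<in> D \<and> conn (B \<inter> D) a b \<or> (\<exists>x y. conn (B \<inter> D) a x \<and> x \<in> D \<and> y \<in> B - D \<and> E x y)"
    using assms(1)
  proof (induction rule: conn_induct)
    case base show ?case using assms conn_in(1)[OF assms(1)] by (auto intro!: conn_refl)
  next
    case (step x y)
    then show ?case by (cases "y \<in> D") (auto intro: conn_trans conn_step)
  qed
  with assms that show ?thesis by blast
qed

lemma conn_stays:
  assumes "conn B a b" "a \<in> D" "\<And>x y. \<lbrakk>E x y; x \<in> D; x \<in> B; y \<in> B\<rbrakk> \<Longrightarrow> y \<in> D"
  shows "b \<in> D"
proof (rule ccontr)
  assume "b \<notin> D"
  then obtain x y where "conn (B \<inter> D) a x" "x \<in> D" "y \<in> B - D" "E x y"
    using conn_leave[OF assms(1,2)] by metis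
  then show False using assms(3)[of x y] conn_in(2)[of "B \<inter> D" a x] by blast
qed

lemma conndD: "connd B \<Longrightarrow> a \<in> B \<Longrightarrow> b \<in> B \<Longrightarrow> conn B a b"
  by (simp add: connd_def)

lemma comp_of: "a \<in> B \<Longrightarrow> \<exists>D\<in>comps B. a \<in> D"
  unfolding comps_def using conn_refl by blast

lemma comps_sub: "D \<in> comps B \<Longrightarrow> D \<subseteq> B"
  unfolding comps_def by (auto dest: conn_in)

lemma comps_ne: "D \<in> comps B \<Longrightarrow> D \<noteq> {}"
  unfolding comps_def using conn_refl by blast

lemma comps_eq: "D \<in> comps B \<Longrightarrow> a \<in> D \<Longrightarrow> D = {b. conn B a b}"
  unfolding comps_def using conn_trans conn_sym by blast

lemma comps_disj: "D \<in> comps B \<Longrightarrow> D' \<in> comps B \<Longrightarrow> a \<in> D \<Longrightarrow> a \<in> D' \<Longrightarrow> D = D'"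
  using comps_eq by blast

lemma comps_closed: "D \<in> comps B \<Longrightarrow> E x y \<Longrightarrow> x \<in> D \<Longrightarrow> y \<in> B \<Longrightarrow> y \<in> D"
  using comps_eq comps_sub conn_step by blast

lemma comps_connd: assumes "D \<in> comps B" shows "connd D"
proof -
  have "conn D a b" if "a \<in> D" "b \<in> D" for a b
  proof -
    have "conn B a b" using comps_eq[OF assms that(1)] that(2) by blast
    then have "b \<in> D \<and> conn D a b"
    proof (induction rule: conn_induct)
      case (step x y)
      then show ?case by (meson assms comps_closed conn_step conn_trans)
    qed (use that in \<open>auto intro: conn_refl\<close>)
    then show ?thesis by blast
  qed
  then show ?thesis by (simp add: connd_def)
qed

lemma connd_in_comp:
  assumes "connd C" "C \<subseteq> B" "D \<in> comps B" "a \<in> C" "a \<in> D"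
  shows "C \<subseteq> D"
proof
  fix b assume "b \<in> C"
  then have "conn B a b" using assms conndD conn_mono by blast
  then show "b \<in> D" using comps_eq assms by blast
qed

end

section \<open>Rays and closures\<close>

context sym_rel
begin

definition rayin :: "'a set \<Rightarrow> (nat \<Rightarrow> 'a) \<Rightarrow> bool" where
  "rayin B r \<longleftrightarrow> inj r \<and> range r \<subseteq> B \<and> (\<forall>n. E (r n) (r (Suc n)))"

text \<open>For a ray in \<open>B\<close> the choice of \<open>n\<close> is immaterial, since two
  tails that avoid \<open>S\<close> are joined along the ray; \<open>tconnD\<close> makes this
  usable.\<close>

definition tconn :: "'a set \<Rightarrow> 'a set \<Rightarrow> (nat \<Rightarrow> 'a) \<Rightarrow> 'a \<Rightarrow> bool" where
  "tconn B S r u \<longleftrightarrow> (\<exists>n. (\<forall>m\<ge>n. r m \<notin> S) \<and> conn (B - S) (r n) u)"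

text \<open>The end of the ray \<open>r\<close>, in the subgraph induced on \<open>B\<close>, lies in the closure of \<open>U\<close>.\<close>

definition limray :: "'a set \<Rightarrow> 'a set \<Rightarrow> (nat \<Rightarrow> 'a) \<Rightarrow> bool" where
  "limray B U r \<longleftrightarrow> (\<forall>S. finite S \<longrightarrow> (\<exists>u\<in>U. tconn B S r u))"

text \<open>Equivalent to domination of the end of \<open>r\<close>: disjoint paths can be picked greedily.\<close>

definition domin :: "'a set \<Rightarrow> 'a \<Rightarrow> (nat \<Rightarrow> 'a) \<Rightarrow> bool" where
  "domin B x r \<longleftrightarrow> (\<forall>S. finite S \<and> x \<notin> S \<longrightarrow> tconn B S r x)"

text \<open>For \<open>c\<close> outside \<open>U\<close> this says that there is an infinite fan
  from \<open>c\<close> to \<open>U\<close> inside \<open>B\<close>: infinitely many paths sharing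
  only \<open>c\<close>. The form with finite separators avoids handling the paths.\<close>

definition fan_closure :: "'a set \<Rightarrow> 'a set \<Rightarrow> 'a set" where
  "fan_closure B U = {c \<in> B. \<forall>S. finite S \<and> c \<notin> S \<longrightarrow> (\<exists>u\<in>U. conn (B - S) c u)}"

lemma rayin_tail_avoids:
  fixes r :: "nat \<Rightarrow> 'a"
  assumes "inj r" "finite S"
  obtains n where "\<forall>m\<ge>n. r m \<notin> S"
proof -
  have "finite (r -` S)" using assms by (simp add: finite_vimageI)
  then obtain n where "\<forall>m\<in>r -` S. m < n" using finite_nat_set_iff_bounded by metis
  then show ?thesis using that[of n] by (metis leD vimageI)
qed

lemma ray_conn_le:
  assumes "\<And>k. E (r k) (r (Suc k))" "\<And>k. k \<ge> n \<Longrightarrow> r k \<in> B" "n \<le> m"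
  shows "conn B (r n) (r m)"
  using assms(3)
proof (induction m rule: dec_induct)
  case base then show ?case using assms by (auto intro: conn_refl)
next
  case (step k) then show ?case
    using assms conn_step[of "r k" "r (Suc k)"] conn_trans by (meson le_Suc_eq)
qed

lemma ray_conn:
  assumes "\<And>k. E (r k) (r (Suc k))" "\<And>k. k \<ge> n \<Longrightarrow> r k \<in> B" "n \<le> m" "n \<le> m'"
  shows "conn B (r m) (r m')"
proof -
  have "conn B (r n) (r i)" if "n \<le> i" for i
    by (rule ray_conn_le) (use assms that in auto)
  then show ?thesis using assms(3,4) conn_sym conn_trans by meson
qed

lemma tconnD:
  assumes "tconn B S r u" "rayin B r" "\<forall>m\<ge>n. r m \<notin> S"
  shows "conn (B - S) (r n) u"
proof -
  obtain k where k: "\<forall>m\<ge>k. r m \<notin> S" "conn (B - S) (r k) u"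
    using assms by (auto simp: tconn_def)
  have "conn (B - S) (r n) (r k)"
    by (rule ray_conn[where n = "min n k"]) (use assms k in \<open>auto simp: rayin_def min_le_iff_disj\<close>)
  then show ?thesis using k conn_trans by blast
qed

lemma tconn_mono:
  assumes "tconn B S r u" "B \<subseteq> B'" "S' \<subseteq> S"
  shows "tconn B' S' r u"
proof -
  have "B - S \<subseteq> B' - S'" using assms by blast
  then show ?thesis using assms unfolding tconn_def by (meson conn_mono subsetD)
qed

lemma tconn_in: "tconn B S r u \<Longrightarrow> u \<in> B - S"
  unfolding tconn_def by (auto dest: conn_in)

lemma tconn_trans: "tconn B S r u \<Longrightarrow> conn (B - S) u v \<Longrightarrow> tconn B S r v"
  unfolding tconn_def using conn_trans by blast

text \<open>The closure vertex \<open>c\<close> reached by the ray is not in \<open>S\<close>, so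
  \<open>S\<close> is an admissible separator for \<open>c\<close> and fails to cut \<open>c\<close>
  off from \<open>U\<close>.\<close>

lemma limray_fan_closure:
  assumes "limray B (fan_closure B U) r"
  shows "limray B U r"
  unfolding limray_def
proof (intro allI impI)
  fix S :: "'a set" assume S: "finite S"
  then obtain c where c: "c \<in> fan_closure B U" "tconn B S r c" using assms by (auto simp: limray_def)
  then have "c \<notin> S" using tconn_in by blast
  then obtain u where "u \<in> U" "conn (B - S) c u" using c(1) S by (auto simp: fan_closure_def)
  then show "\<exists>u\<in>U. tconn B S r u" using c tconn_trans by blast
qed

lemma fan_closure_extensive: "U \<subseteq> B \<Longrightarrow> U \<subseteq> fan_closure B U"
  unfolding fan_closure_def using conn_refl by blast

lemma fan_closure_idem: "fan_closure B (fan_closure B U) \<subseteq> fan_closure B U"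
proof
  fix c assume c: "c \<in> fan_closure B (fan_closure B U)"
  have "\<exists>u\<in>U. conn (B - S) c u" if S: "finite S" "c \<notin> S" for S
  proof -
    obtain d where d: "d \<in> fan_closure B U" "conn (B - S) c d" using c S by (auto simp: fan_closure_def)
    then have "d \<notin> S" using conn_in(2)[OF d(2)] by blast
    then obtain u where "u \<in> U" "conn (B - S) d u" using d S by (auto simp: fan_closure_def)
    then show ?thesis using d conn_trans by blast
  qed
  then show "c \<in> fan_closure B U" using c by (auto simp: fan_closure_def)
qed

text \<open>A point of \<open>S\<close> chosen in each \<open>F i\<close> that meets
  \<open>S\<close> determines \<open>i\<close>, by disjointness.\<close>

lemma finite_meeting_disjoint:
  assumes "finite S" "\<And>i j. \<lbrakk>i \<in> I; j \<in> I; i \<noteq> j\<rbrakk> \<Longrightarrow> F i \<inter> F j = {}"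
  shows "finite {i \<in> I. F i \<inter> S \<noteq> {}}"
proof (rule inj_on_finite)
  let ?g = "\<lambda>i. SOME x. x \<in> F i \<inter> S"
  have g: "?g i \<in> F i \<inter> S" if "i \<in> {i \<in> I. F i \<inter> S \<noteq> {}}" for i
    by (rule someI_ex) (use that in blast)
  show "?g ` {i \<in> I. F i \<inter> S \<noteq> {}} \<subseteq> S" using g by blast
  show "inj_on ?g {i \<in> I. F i \<inter> S \<noteq> {}}"
  proof (rule inj_onI, rule ccontr)
    fix i j assume ij: "i \<in> {i \<in> I. F i \<inter> S \<noteq> {}}" "j \<in> {i \<in> I. F i \<inter> S \<noteq> {}}" "?g i = ?g j" "i \<noteq> j"
    then have "F i \<inter> F j = {}" using assms(2) by simp
    then show False using g[OF ij(1)] g[OF ij(2)] ij(3) by auto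
  qed
qed fact

text \<open>Suppose \<open>S\<close> cuts the ray \<open>r\<close> off from \<open>U\<close>. A ray
  of \<open>R\<close> that misses \<open>S\<close> cannot be reached from \<open>r\<close>, as it
  would lead on to \<open>U\<close>. Only finitely many rays of \<open>R\<close> meet
  \<open>S\<close>, and each can be reached in finitely many vertices only; deleting these too cuts
  \<open>r\<close> off from the larger set.\<close>

lemma limray_add_rays:
  assumes R: "\<And>s. s \<in> R \<Longrightarrow> rayin B s \<and> limray B U s"
    and disj: "\<And>s s'. \<lbrakk>s \<in> R; s' \<in> R; s \<noteq> s'\<rbrakk> \<Longrightarrow> range s \<inter> range s' = {}"
    and lim: "limray B (U \<union> (\<Union>s\<in>R. range s)) r"
  shows "limray B U r"
  unfolding limray_def
proof (intro allI impI, rule ccontr)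
  fix S :: "'a set" assume S: "finite S" and no: "\<not> (\<exists>u\<in>U. tconn B S r u)"
  define F where "F = {s \<in> R. range s \<inter> S \<noteq> {}}"
  have finF: "finite F" unfolding F_def by (rule finite_meeting_disjoint[OF S disj])
  \<comment> \<open>The end of \<open>s\<close> is itself in the closure of \<open>U\<close>, so a
    tail of \<open>s\<close> avoiding \<open>S\<close> continues to \<open>U\<close> off
    \<open>S\<close>.\<close>
  have no_tail: "\<not> tconn B S r (s m)" if s: "s \<in> R" and k: "\<forall>i\<ge>k. s i \<notin> S" "m \<ge> k" for s m k
  proof
    assume sm: "tconn B S r (s m)"
    obtain u where u: "u \<in> U" "tconn B S s u" using R[OF s] S by (auto simp: limray_def)
    have "conn (B - S) (s m) u" by (rule tconnD[OF u(2)]) (use R[OF s] k in auto)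
    then show False using sm tconn_trans u(1) no by blast
  qed
  have fin: "finite {m. tconn B S r (s m)}" if "s \<in> F" for s
  proof -
    have s: "s \<in> R" using that by (simp add: F_def)
    then obtain k where k: "\<forall>i\<ge>k. s i \<notin> S" using R S rayin_tail_avoids unfolding rayin_def by metis
    have "m < k" if "tconn B S r (s m)" for m
      using no_tail[OF s k] that not_less by blast
    then have "{m. tconn B S r (s m)} \<subseteq> {..<k}" by auto
    then show ?thesis by (rule finite_subset) simp
  qed
  \<comment> \<open>The vertices added to \<open>S\<close> are those that \<open>r\<close> reaches
    on the finitely many rays meeting \<open>S\<close>.\<close>
  define S' where "S' = S \<union> (\<Union>s\<in>F. s ` {m. tconn B S r (s m)})"
  have "finite S'" unfolding S'_def using S finF fin by blast
  then obtain u where u: "u \<in> U \<union> (\<Union>s\<in>R. range s)" "tconn B S' r u"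
    using lim unfolding limray_def by blast
  have uS: "tconn B S r u" by (rule tconn_mono[OF u(2)]) (auto simp: S'_def)
  have "u \<notin> S'" using u(2) tconn_in by blast
  obtain s m where s: "s \<in> R" "u = s m" using u(1) uS no by blast
  show False
  proof (cases "s \<in> F")
    case True
    then have "u \<in> S'" using s uS by (auto simp: S'_def)
    then show False using \<open>u \<notin> S'\<close> by blast
  next
    case False
    then have "\<forall>i\<ge>0. s i \<notin> S" using s by (auto simp: F_def)
    then show False using no_tail[OF s(1), of 0 m] uS s by simp
  qed
qed

text \<open>A form of the star-comb lemma: fan-closedness of \<open>W\<close> excludes the star, so the breadth-first
  tree of \<open>K\<close> has a vertex with infinitely many neighbours of \<open>K\<close> above it at every level.\<close>

lemma ray_of_infinite_nb:
  assumes K: "K \<in> comps (B - W)" and closed: "fan_closure B W \<subseteq> W" and inf: "infinite (nb B K)"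
  shows "\<exists>r. rayin K r \<and> limray B W r"
proof -
  have KB: "K \<subseteq> B - W" using K comps_sub by blast
  have nbW: "nb B K \<subseteq> W" using K comps_closed unfolding nb_def by blast
  obtain c0 where c0: "c0 \<in> K" using K comps_ne by blast
  let ?R = "\<lambda>x y. E x y \<and> x \<in> K \<and> y \<in> K"
  define d where "d v = (LEAST n. (?R ^^ n) c0 v)" for v
  have dex: "\<exists>n. (?R ^^ n) c0 v" if "v \<in> K" for v
    using conndD[OF comps_connd[OF K] c0 that] unfolding conn_def by (simp add: rtranclp_power)
  have dR: "(?R ^^ d v) c0 v" if "v \<in> K" for v
    unfolding d_def using LeastI_ex[OF dex[OF that]] .
  have dle: "(?R ^^ n) c0 v \<Longrightarrow> d v \<le> n" for n v unfolding d_def by (rule Least_le)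
  have d0: "d c0 = 0" using dle[of 0 c0] by simp
  have "\<exists>u\<in>K. E u v \<and> d v = Suc (d u)" if v: "v \<in> K" "v \<noteq> c0" for v
  proof -
    obtain n where n: "d v = Suc n" using dR[OF v(1)] v(2) by (cases "d v") auto
    then obtain u where u: "(?R ^^ n) c0 u" "?R u v" using dR[OF v(1)] by auto
    have "d u \<le> n" using dle u by blast
    moreover have "d v \<le> Suc (d u)" by (rule dle) (use dR u in auto)
    ultimately show ?thesis using n u by auto
  qed
  then obtain p where p: "\<And>v. \<lbrakk>v \<in> K; v \<noteq> c0\<rbrakk> \<Longrightarrow> p v \<in> K \<and> E (p v) v \<and> d v = Suc (d (p v))"
    by metis
  \<comment> \<open>\<open>v\<close> is an ancestor of \<open>y\<close> in the tree given by
    \<open>p\<close>. The condition on levels keeps the iteration from running past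
    \<open>c0\<close>, where \<open>p\<close> is unspecified.\<close>
  define anc where "anc v y \<longleftrightarrow> v \<in> K \<and> y \<in> K \<and> (\<exists>n. d y = n + d v \<and> (p ^^ n) y = v)" for v y
  have anc_refl: "anc v v" if "v \<in> K" for v unfolding anc_def using that by (intro conjI exI[of _ 0]) auto
  have anc_d: "anc v y \<Longrightarrow> d v \<le> d y" for v y unfolding anc_def by auto
  have anc_uniq: "w = w'" if "anc w y" "anc w' y" "d w = d w'" for w w' y
    using that unfolding anc_def by (metis add_right_cancel)
  have ne_c0: "d y = Suc k \<Longrightarrow> y \<noteq> c0" for y k using d0 by auto
  have anc_ind: "anc v y \<and> P y" if "anc v y" "P v" "\<And>y. \<lbrakk>y \<in> K; y \<noteq> c0; anc v y; anc v (p y); P (p y)\<rbrakk> \<Longrightarrow> P y" for v y P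
  proof -
    have "\<forall>y. y \<in> K \<longrightarrow> v \<in> K \<longrightarrow> d y = n + d v \<longrightarrow> (p ^^ n) y = v \<longrightarrow> P y" for n
    proof (induction n)
      case 0 then show ?case using that by auto
    next
      case (Suc n)
      show ?case
      proof (intro allI impI)
        fix y assume y: "y \<in> K" "v \<in> K" "d y = Suc n + d v" "(p ^^ Suc n) y = v"
        have nc: "y \<noteq> c0" using y(3) ne_c0 by simp
        have py: "p y \<in> K" "d (p y) = n + d v" "(p ^^ n) (p y) = v"
          using p[OF y(1) nc] y by (auto simp: funpow_swap1)
        have "anc v (p y)" "anc v y" unfolding anc_def using y py by blast+
        then show "P y" using that(3)[OF y(1) nc] Suc.IH py y(2) by blast
      qed
    qed
    then show ?thesis using that(1) unfolding anc_def by blast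
  qed
  have anc_conn: "conn {x. anc v x} v y" if vy: "anc v y" for v y
  proof -
    have "anc v y \<and> conn {x. anc v x} v y"
      using vy
    proof (rule anc_ind)
      show "conn {x. anc v x} v v" using vy anc_refl by (auto intro!: conn_refl simp: anc_def)
    next
      fix y assume "y \<in> K" "y \<noteq> c0" "anc v y" "anc v (p y)" "conn {x. anc v x} v (p y)"
      then show "conn {x. anc v x} v y" using p conn_step[of "p y" y "{x. anc v x}"] conn_trans by blast
    qed
    then show ?thesis by blast
  qed
  define ch where "ch v = {w \<in> K. w \<noteq> c0 \<and> p w = v}" for v
  have anc_ch: "y = v \<or> (\<exists>w\<in>ch v. anc w y)" if vy: "anc v y" for v y
  proof -
    have "anc v y \<and> (y = v \<or> (\<exists>w\<in>ch v. anc w y))"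
      using vy
    proof (rule anc_ind)
      fix y assume y: "y \<in> K" "y \<noteq> c0" "anc v y" "anc v (p y)" "p y = v \<or> (\<exists>w\<in>ch v. anc w (p y))"
      show "y = v \<or> (\<exists>w\<in>ch v. anc w y)"
      proof (cases "p y = v")
        case True then show ?thesis using y anc_refl by (auto simp: ch_def)
      next
        case False
        then obtain w where w: "w \<in> ch v" "anc w (p y)" using y by blast
        then obtain n where "d (p y) = n + d w" "(p ^^ n) (p y) = w" "w \<in> K" by (auto simp: anc_def)
        then have "d y = Suc n + d w" "(p ^^ Suc n) y = w" using p y by (auto simp: funpow_swap1)
        then have "anc w y" using y \<open>w \<in> K\<close> unfolding anc_def by blast
        then show ?thesis using w by blast
      qed
    qed simp
    then show ?thesis by blast
  qed
  have "\<forall>a\<in>nb B K. \<exists>x. x \<in> K \<and> E x a" unfolding nb_def by blast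
  then obtain f where f: "\<And>a. a \<in> nb B K \<Longrightarrow> f a \<in> K \<and> E (f a) a" by metis
  \<comment> \<open>Every neighbour \<open>a\<close> of \<open>K\<close> is attached at one chosen
    vertex \<open>f a\<close>. \<open>A v\<close> collects those attached at \<open>v\<close> or
    above; its infinity is what is carried up the tree.\<close>
  define A where "A v = {a \<in> nb B K. anc v (f a)}" for v
  have root: "infinite (A c0)"
  proof -
    have "(p ^^ n) y = c0" if "y \<in> K" "d y = n" for n y
      using that
    proof (induction n arbitrary: y)
      case 0 then show ?case using dR[of y] by auto
    next
      case (Suc n)
      then have "p y \<in> K \<and> d (p y) = n" using p ne_c0 by (metis nat.inject)
      then show ?case using Suc by (auto simp: funpow_swap1)
    qed
    then have "anc c0 y" if "y \<in> K" for y unfolding anc_def using that c0 d0 by auto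
    then have "A c0 = nb B K" unfolding A_def using f by auto
    then show ?thesis using inf by simp
  qed
  have step: "\<exists>w\<in>ch v. infinite (A w)" if v: "v \<in> K" "infinite (A v)" for v
  proof (rule ccontr)
    assume no: "\<not> (\<exists>w\<in>ch v. infinite (A w))"
    have "v \<in> B" "v \<notin> W" using v KB by auto
    moreover from this have "v \<notin> fan_closure B W" using closed by blast
    ultimately obtain S where S: "finite S" "v \<notin> S" "\<forall>u\<in>W. \<not> conn (B - S) v u"
      unfolding fan_closure_def by auto
    \<comment> \<open>The trees above distinct children of \<open>v\<close> are disjoint, so only
      finitely many meet \<open>S\<close>. In a tree avoiding \<open>S\<close>, a neighbour of
      \<open>K\<close> attached there must itself lie in \<open>S\<close>, since otherwise
      \<open>v\<close> would reach \<open>W\<close> off \<open>S\<close>. This makes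
      \<open>A v\<close> finite.\<close>
    define bad where "bad = {w \<in> ch v. {y. anc w y} \<inter> S \<noteq> {}}"
    have "finite bad" unfolding bad_def
    proof (rule finite_meeting_disjoint[OF S(1)])
      fix w w' assume ww: "w \<in> ch v" "w' \<in> ch v" "w \<noteq> w'"
      then have "d w = d w'" using p unfolding ch_def by (metis (mono_tags, lifting) mem_Collect_eq)
      then show "{y. anc w y} \<inter> {y. anc w' y} = {}" using anc_uniq ww by blast
    qed
    moreover have "A v \<subseteq> S \<union> (\<Union>w\<in>bad. A w)"
    proof
      fix a assume a: "a \<in> A v"
      then have aN: "a \<in> nb B K" "anc v (f a)" by (auto simp: A_def)
      have aW: "a \<in> W" "a \<in> B" using aN nbW by (auto simp: nb_def)
      show "a \<in> S \<union> (\<Union>w\<in>bad. A w)"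
      proof (rule ccontr)
        assume na: "a \<notin> S \<union> (\<Union>w\<in>bad. A w)"
        have ncon: "\<not> conn (B - S) v a" using S aW by blast
        have fa: "f a \<in> B" "E (f a) a" using f aN KB by auto
        show False
        proof (cases "f a = v")
          case True
          then show False using ncon conn_step[of "f a" a "B - S"] fa aW na S by auto
        next
          case False
          then obtain w where w: "w \<in> ch v" "anc w (f a)" using anc_ch aN by blast
          then have "w \<notin> bad" using na aN by (auto simp: A_def)
          then have dis: "{y. anc w y} \<inter> S = {}" using w by (auto simp: bad_def)
          have wK: "w \<in> K" "E v w" using w(1) p by (auto simp: ch_def)
          have "{y. anc w y} \<subseteq> B - S" using dis KB by (auto simp: anc_def)
          then have "conn (B - S) w (f a)" using anc_conn[OF w(2)] conn_mono by blast
          moreover have "conn (B - S) v w"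
            by (rule conn_step) (use wK v S KB dis anc_refl in auto)
          moreover have "conn (B - S) (f a) a"
            by (rule conn_step) (use fa aW na conn_in(2)[OF calculation(1)] in auto)
          ultimately show False using ncon conn_trans by blast
        qed
      qed
    qed
    moreover have "finite (\<Union>w\<in>bad. A w)" using \<open>finite bad\<close> no by (auto simp: bad_def)
    ultimately show False using v(2) S(1) finite_subset by blast
  qed
  have "\<exists>r. \<forall>n. (r n \<in> K \<and> infinite (A (r n)) \<and> d (r n) = n) \<and> r (Suc n) \<in> ch (r n)"
  proof (rule dependent_nat_choice)
    show "\<exists>x. x \<in> K \<and> infinite (A x) \<and> d x = 0" using c0 root d0 by blast
  next
    fix x n assume x: "x \<in> K \<and> infinite (A x) \<and> d x = n"
    then obtain w where "w \<in> ch x" "infinite (A w)" using step by blast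
    then show "\<exists>y. (y \<in> K \<and> infinite (A y) \<and> d y = Suc n) \<and> y \<in> ch x" using p x by (auto simp: ch_def)
  qed
  then obtain r where r: "\<And>n. r n \<in> K" "\<And>n. infinite (A (r n))" "\<And>n. d (r n) = n" "\<And>n. r (Suc n) \<in> ch (r n)"
    by blast
  have rE: "E (r n) (r (Suc n))" for n using r(4)[of n] p[of "r (Suc n)"] by (auto simp: ch_def)
  have "inj r" by (metis r(3) injI)
  then have ray: "rayin K r" using r(1) rE by (auto simp: rayin_def)
  have "limray B W r" unfolding limray_def
  proof (intro allI impI)
    fix S :: "'a set" assume S: "finite S"
    \<comment> \<open>\<open>N\<close> exceeds all levels occurring in \<open>S\<close>. The whole
      tree above \<open>r N\<close> then avoids \<open>S\<close>, while infinitely many neighbours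
      of \<open>K\<close> are attached to it.\<close>
    then obtain N where N: "\<forall>k\<in>d ` S. k < N" using finite_nat_set_iff_bounded by blast
    have av: "\<forall>m\<ge>N. r m \<notin> S" using N r(3) by (metis imageI leD)
    obtain a where a: "a \<in> A (r N)" "a \<notin> S" using r(2)[of N] S by (meson finite_subset subsetI)
    then have aN: "a \<in> nb B K" "anc (r N) (f a)" by (auto simp: A_def)
    have sub: "{y. anc (r N) y} \<subseteq> B - S"
    proof
      fix y assume "y \<in> {y. anc (r N) y}"
      then have "d y \<ge> N" "y \<in> K" using anc_d[of "r N" y] r(3) by (auto simp: anc_def)
      then show "y \<in> B - S" using KB N by (meson DiffD1 DiffI imageI leD subsetD)
    qed
    have c1: "conn (B - S) (r N) (f a)" using anc_conn[OF aN(2)] sub conn_mono by blast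
    have "conn (B - S) (f a) a"
      by (rule conn_step) (use f aN a conn_in(2)[OF c1] in \<open>auto simp: nb_def\<close>)
    then have "conn (B - S) (r N) a" using c1 conn_trans by blast
    then show "\<exists>u\<in>W. tconn B S r u" using av aN nbW unfolding tconn_def by blast
  qed
  then show ?thesis using ray by blast
qed

end

section \<open>Parts\<close>

context sym_rel
begin

lemma connd_from: "(\<And>b. b \<in> B \<Longrightarrow> conn B x b) \<Longrightarrow> connd B"
  unfolding connd_def by (meson conn_sym conn_trans)

lemma connd_insert:
  assumes P: "connd P" "x \<in> P" "E x y"
  shows "connd (insert y P)"
proof -
  have "conn (insert y P) x b" if "b \<in> insert y P" for b
  proof (cases "b = y")
    case True then show ?thesis using P conn_step[of x y "insert y P"] by simp
  next
    case False
    then show ?thesis using that conndD[OF P(1,2)] conn_mono[of P x b "insert y P"] by blast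
  qed
  then show ?thesis by (rule connd_from)
qed

lemma connd_union:
  assumes "connd P" "connd Q" "x \<in> P" "x \<in> Q"
  shows "connd (P \<union> Q)"
proof -
  have "conn (P \<union> Q) x b" if "b \<in> P \<union> Q" for b
    using that conndD[OF assms(1,3)] conndD[OF assms(2,4)]
      conn_mono[of P x b "P \<union> Q"] conn_mono[of Q x b "P \<union> Q"] by blast
  then show ?thesis by (rule connd_from)
qed

lemma finite_connd_path:
  assumes "conn C a b"
  shows "\<exists>P. finite P \<and> P \<subseteq> C \<and> connd P \<and> a \<in> P \<and> b \<in> P"
  using assms
proof (induction rule: conn_induct)
  case base
  have "connd {a}" by (auto simp: connd_def intro: conn_refl)
  then show ?case using conn_in(1)[OF assms] by (intro exI[of _ "{a}"]) simp
next
  case (step x y)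
  then obtain P where "finite P" "P \<subseteq> C" "connd P" "a \<in> P" "x \<in> P" by blast
  then show ?case using step connd_insert[of P x y] by (intro exI[of _ "insert y P"]) auto
qed

lemma finite_connd_superset:
  assumes "connd C" "finite Q" "Q \<subseteq> C"
  shows "\<exists>F. finite F \<and> Q \<subseteq> F \<and> F \<subseteq> C \<and> connd F"
  using assms(2,3)
proof (induction rule: finite_induct)
  case empty then show ?case by (intro exI[of _ "{}"]) (simp add: connd_def)
next
  case (insert q Q)
  then obtain F where F: "finite F" "Q \<subseteq> F" "F \<subseteq> C" "connd F" by blast
  show ?case
  proof (cases "F = {}")
    case True
    have "connd {q}" by (auto simp: connd_def intro: conn_refl)
    then show ?thesis using True F insert.prems by (intro exI[of _ "{q}"]) auto
  next
    case False
    then obtain f where f: "f \<in> F" by blast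
    then have "conn C f q" using conndD[OF assms(1)] F insert.prems by auto
    from finite_connd_path[OF this] obtain P where
      P: "finite P" "P \<subseteq> C" "connd P" "f \<in> P" "q \<in> P" by blast
    have "connd (F \<union> P)" by (rule connd_union) (use F P f in auto)
    then show ?thesis using F P by (intro exI[of _ "F \<union> P"]) auto
  qed
qed

lemma nb_ne:
  assumes "connd B" "W \<subseteq> B" "W \<noteq> {}" "K \<in> comps (B - W)"
  shows "nb B K \<noteq> {}"
proof -
  obtain a w where aw: "a \<in> K" "w \<in> W" using assms comps_ne by blast
  have KB: "K \<subseteq> B - W" using comps_sub[OF assms(4)] .
  have "conn B a w" using conndD[OF assms(1)] aw assms(2) KB by blast
  moreover have "w \<notin> K" using aw KB by blast
  ultimately obtain x y where "x \<in> K" "y \<in> B - K" "E x y"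
    using conn_leave[OF _ aw(1)] by metis
  then show ?thesis unfolding nb_def by blast
qed

lemma nb_comp_sub: "K \<in> comps (B - W) \<Longrightarrow> nb B K \<subseteq> W"
  using comps_closed unfolding nb_def by blast

lemma connd_with_nb:
  assumes "connd K" shows "connd (K \<union> nb B K)"
proof (cases "K = {}")
  case True then show ?thesis by (auto simp: nb_def connd_def)
next
  case False
  then obtain a where a: "a \<in> K" by blast
  have "conn (K \<union> nb B K) a b" if b: "b \<in> K \<union> nb B K" for b
  proof (cases "b \<in> K")
    case True then show ?thesis using conndD[OF assms a] conn_mono[of K a b] by blast
  next
    case False
    then obtain x where x: "x \<in> K" "E x b" using b by (auto simp: nb_def)
    then have "conn (K \<union> nb B K) a x" using conndD[OF assms a] conn_mono[of K a x] by auto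
    moreover have "conn (K \<union> nb B K) x b" by (rule conn_step) (use x b in auto)
    ultimately show ?thesis by (rule conn_trans)
  qed
  then show ?thesis by (rule connd_from)
qed

text \<open>The order of the two enlargements matters. Closing last makes \<open>W\<close>
  fan-closed, as \<open>ray_of_infinite_nb\<close> requires, and \<open>W\<close> still contains all
  rays of \<open>R\<close>. A ray found in a component with infinite neighbourhood is therefore
  disjoint from them and could be added, against maximality.\<close>

lemma finite_adhesion_superset:
  assumes U: "U \<subseteq> B"
  shows "\<exists>W. U \<subseteq> W \<and> W \<subseteq> B \<and> (\<forall>K\<in>comps (B - W). finite (nb B K)) \<and>
    (\<forall>r. limray B W r \<longrightarrow> limray B U r)"
proof -
  let ?C = "{R. R \<subseteq> {s. rayin B s \<and> limray B U s} \<and>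
    (\<forall>s\<in>R. \<forall>s'\<in>R. s \<noteq> s' \<longrightarrow> range s \<inter> range s' = {})}"
  have "\<exists>M\<in>?C. \<forall>X\<in>?C. M \<subseteq> X \<longrightarrow> X = M"
  proof (rule subset_Zorn_nonempty)
    show "?C \<noteq> {}" by (auto intro: exI[of _ "{}"])
  next
    fix \<C> assume ne: "\<C> \<noteq> {}" and ch: "subset.chain ?C \<C>"
    have sub: "\<C> \<subseteq> ?C" using ch by (simp add: subset_chain_def)
    have lin: "X \<subseteq> Y \<or> Y \<subseteq> X" if "X \<in> \<C>" "Y \<in> \<C>" for X Y
      using ch that by (simp add: subset_chain_def)
    have "range s \<inter> range s' = {}" if "s \<in> \<Union>\<C>" "s' \<in> \<Union>\<C>" "s \<noteq> s'" for s s'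
    proof -
      obtain X Y where XY: "X \<in> \<C>" "s \<in> X" "Y \<in> \<C>" "s' \<in> Y" using \<open>s \<in> _\<close> \<open>s' \<in> _\<close> by blast
      then obtain Z where "Z \<in> \<C>" "s \<in> Z" "s' \<in> Z" using lin[of X Y] by blast
      then show ?thesis using sub that(3) by blast
    qed
    then show "\<Union>\<C> \<in> ?C" using sub by blast
  qed
  then obtain R where R: "R \<in> ?C" and max: "\<forall>X\<in>?C. R \<subseteq> X \<longrightarrow> X = R" by (rule bexE)
  define U' where "U' = U \<union> (\<Union>s\<in>R. range s)"
  define W where "W = fan_closure B U'"
  have Rray: "rayin B s" "limray B U s" if "s \<in> R" for s using R that by auto
  have U': "U' \<subseteq> B" unfolding U'_def using U Rray(1) unfolding rayin_def by blast
  have UW: "U' \<subseteq> W" unfolding W_def by (rule fan_closure_extensive[OF U'])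
  have WB: "W \<subseteq> B" unfolding W_def fan_closure_def by blast
  have lim: "limray B U r" if "limray B W r" for r
  proof (rule limray_add_rays)
    show "limray B (U \<union> (\<Union>s\<in>R. range s)) r"
      using limray_fan_closure that unfolding W_def U'_def by blast
  next
    show "rayin B s \<and> limray B U s" if "s \<in> R" for s using Rray that by blast
    show "range s \<inter> range s' = {}" if "s \<in> R" "s' \<in> R" "s \<noteq> s'" for s s' using R that by blast
  qed
  have "finite (nb B K)" if K: "K \<in> comps (B - W)" for K
  proof (rule ccontr)
    assume "infinite (nb B K)"
    then obtain r where r: "rayin K r" "limray B W r"
      using ray_of_infinite_nb[OF K] fan_closure_idem unfolding W_def by blast
    have KB: "K \<subseteq> B - W" by (rule comps_sub[OF K])
    then have rB: "rayin B r" using r(1) by (auto simp: rayin_def)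
    have dis: "range r \<inter> range s = {}" if "s \<in> R" for s
    proof -
      have "range s \<subseteq> W" using that UW unfolding U'_def by blast
      then show ?thesis using KB r(1) by (auto simp: rayin_def)
    qed
    have "insert r R \<in> ?C"
      using R rB lim[OF r(2)] dis by (auto simp: Int_commute)
    from bspec[OF max this] have "r \<in> R" by blast
    then show False using dis by blast
  qed
  then show ?thesis using UW WB lim unfolding U'_def by blast
qed

text \<open>The finite set \<open>nb B K\<close> is joined up by a finite connected
  \<open>F K\<close> within \<open>K\<close> and its neighbourhood, so an excursion of a walk into
  \<open>K\<close> can be replaced by one through \<open>F K\<close>. A component of the new rest
  lies in some old \<open>K\<close>, and its neighbours lie in \<open>nb B K\<close> or in the
  finite set \<open>W' \<inter> K\<close>.\<close>

lemma connd_superset: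
  assumes B: "connd B" and W: "W \<subseteq> B" "W \<noteq> {}" and fin: "\<And>K. K \<in> comps (B - W) \<Longrightarrow> finite (nb B K)"
  shows "\<exists>W'. W \<subseteq> W' \<and> W' \<subseteq> B \<and> connd W' \<and> (\<forall>K\<in>comps (B - W'). finite (nb B K)) \<and>
    (\<forall>K\<in>comps (B - W). finite (W' \<inter> K))"
proof -
  have "\<exists>F. finite F \<and> nb B K \<subseteq> F \<and> F \<subseteq> K \<union> nb B K \<and> connd F" if K: "K \<in> comps (B - W)" for K
    by (rule finite_connd_superset) (use fin[OF K] connd_with_nb[OF comps_connd[OF K]] in auto)
  then obtain F where F: "\<And>K. K \<in> comps (B - W) \<Longrightarrow>
      finite (F K) \<and> nb B K \<subseteq> F K \<and> F K \<subseteq> K \<union> nb B K \<and> connd (F K)" by metis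
  define W' where "W' = W \<union> (\<Union>K\<in>comps (B - W). F K)"
  have FW': "F K \<subseteq> W'" if "K \<in> comps (B - W)" for K using that by (auto simp: W'_def)
  have W'B: "W' \<subseteq> B"
  proof -
    have "F K \<subseteq> B" if K: "K \<in> comps (B - W)" for K
      using F[OF K] comps_sub[OF K] nb_comp_sub[OF K] W(1) by blast
    then show ?thesis using W(1) by (auto simp: W'_def)
  qed
  have meet: "finite (W' \<inter> K)" if K: "K \<in> comps (B - W)" for K
  proof -
    have "W' \<inter> K \<subseteq> F K"
    proof
      fix x assume x: "x \<in> W' \<inter> K"
      then have "x \<notin> W" using comps_sub[OF K] by blast
      then obtain K' where K': "K' \<in> comps (B - W)" "x \<in> F K'" using x by (auto simp: W'_def)
      then have "x \<in> K'" using F[OF K'(1)] nb_comp_sub[OF K'(1)] \<open>x \<notin> W\<close> by blast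
      then have "K' = K" using comps_disj K K' x by blast
      then show "x \<in> F K" using K' by simp
    qed
    then show ?thesis using F[OF K] finite_subset by blast
  qed
  obtain w0 where w0: "w0 \<in> W" using W by blast
  \<comment> \<open>While the walk from \<open>w0\<close> is inside \<open>K\<close>, the invariant
    records that all of \<open>nb B K\<close> has been reached in \<open>W'\<close>, so the point at
    which the walk leaves \<open>K\<close> does not matter.\<close>
  have cW: "(x \<in> W \<longrightarrow> conn W' w0 x) \<and> (\<forall>K\<in>comps (B - W). x \<in> K \<longrightarrow> (\<forall>q\<in>nb B K. conn W' w0 q))"
    if "conn B w0 x" for x
    using that
  proof (induction rule: conn_induct)
    case base
    then show ?case using w0 comps_sub conn_refl[of w0 W'] by (auto simp: W'_def)
  next
    case (step x y)
    have yx: "E y x" using step E_sym by blast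
    show ?case
    proof (cases "x \<in> W")
      case True
      then have cx: "conn W' w0 x" using step by blast
      have 1: "conn W' w0 y" if "y \<in> W"
        using cx conn_step[OF \<open>E x y\<close>, of W'] True that conn_trans by (auto simp: W'_def)
      have 2: "conn W' w0 q" if K: "K \<in> comps (B - W)" "y \<in> K" and q: "q \<in> nb B K" for K q
      proof -
        have "x \<in> nb B K" using True K yx step comps_sub[OF K(1)] by (auto simp: nb_def)
        then have "conn (F K) x q" using F[OF K(1)] q conndD by blast
        then show ?thesis using cx FW'[OF K(1)] conn_mono conn_trans by blast
      qed
      show ?thesis using 1 2 by blast
    next
      case False
      then obtain K where K: "K \<in> comps (B - W)" "x \<in> K" using step comp_of[of x "B - W"] by blast
      show ?thesis
      proof (cases "y \<in> W")
        case True
        then have "y \<in> nb B K" using K step comps_sub[OF K(1)] by (auto simp: nb_def)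
        moreover have "y \<notin> K'" if "K' \<in> comps (B - W)" for K' using comps_sub[OF that] True by blast
        ultimately show ?thesis using step K by blast
      next
        case False
        then have "y \<in> K" using comps_closed[OF K(1) \<open>E x y\<close> K(2)] step by blast
        then have "K' = K" if "K' \<in> comps (B - W)" "y \<in> K'" for K' using comps_disj that K by blast
        then show ?thesis using step K False by blast
      qed
    qed
  qed
  have "conn W' w0 y" if y: "y \<in> W'" for y
  proof (cases "y \<in> W")
    case True then show ?thesis using cW conndD[OF B] w0 W(1) by blast
  next
    case False
    then obtain K where K: "K \<in> comps (B - W)" "y \<in> F K" using y by (auto simp: W'_def)
    obtain q where q: "q \<in> nb B K" using nb_ne[OF B W K(1)] by blast
    then have "q \<in> W" using nb_comp_sub[OF K(1)] by blast
    then have "conn W' w0 q" using cW conndD[OF B] w0 W(1) by blast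
    moreover have "conn (F K) q y" using F[OF K(1)] q K(2) conndD by blast
    ultimately show ?thesis using FW'[OF K(1)] conn_mono conn_trans by blast
  qed
  then have conW': "connd W'" by (rule connd_from)
  have "finite (nb B K')" if K': "K' \<in> comps (B - W')" for K'
  proof -
    obtain x where x: "x \<in> K'" using comps_ne[OF K'] by blast
    have K'B: "K' \<subseteq> B - W'" by (rule comps_sub[OF K'])
    then obtain K where K: "K \<in> comps (B - W)" "x \<in> K" using comp_of[of x "B - W"] x by (auto simp: W'_def)
    have "K' \<subseteq> K" by (rule connd_in_comp[OF comps_connd[OF K'] _ K(1) x K(2)]) (use K'B in \<open>auto simp: W'_def\<close>)
    then have "nb B K' \<subseteq> nb B K \<union> (W' \<inter> K)"
      using comps_closed[OF K'] unfolding nb_def by blast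
    then show ?thesis using fin[OF K(1)] meet[OF K(1)] finite_subset by blast
  qed
  then show ?thesis using conW' W'B meet by (intro exI[of _ W']) (auto simp: W'_def)
qed

text \<open>A finite set separating \<open>r\<close> from \<open>W\<close> yields a tail that avoids
  \<open>W\<close>, because every vertex of a tail off that set is reached by the tail. This tail
  stays in one component \<open>K\<close> of \<open>B - W\<close>, and \<open>W'\<close> meets
  \<open>K\<close> in a finite set only, so a later tail avoids \<open>W'\<close> as well.\<close>

lemma ray_settles:
  assumes r: "rayin B r" and nlim: "\<not> limray B W r" and W': "W \<subseteq> W'"
    and fin: "\<And>K. K \<in> comps (B - W) \<Longrightarrow> finite (W' \<inter> K)"
  shows "\<exists>D\<in>comps (B - W'). \<exists>n. \<forall>m\<ge>n. r m \<in> D"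
proof -
  obtain S where S: "finite S" "\<And>u. u \<in> W \<Longrightarrow> \<not> tconn B S r u" using nlim by (auto simp: limray_def)
  have rE: "\<And>k. E (r k) (r (Suc k))" and rB: "\<And>k. r k \<in> B" and inj: "inj r" using r by (auto simp: rayin_def)
  obtain n where n: "\<forall>m\<ge>n. r m \<notin> S" using rayin_tail_avoids[OF inj S(1)] .
  have nW: "r m \<in> B - W" if "m \<ge> n" for m
  proof -
    have "conn (B - S) (r n) (r m)" by (rule ray_conn_le) (use rE rB n that in auto)
    then have "tconn B S r (r m)" using n unfolding tconn_def by blast
    then show ?thesis using S(2) rB by blast
  qed
  obtain K where K: "K \<in> comps (B - W)" "r n \<in> K" using comp_of[OF nW[OF order_refl]] by blast
  have rK: "r m \<in> K" if "m \<ge> n" for m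
  proof -
    have "conn (B - W) (r n) (r m)" by (rule ray_conn_le) (use rE nW that in auto)
    then show ?thesis using comps_eq[OF K] by blast
  qed
  obtain n' where n': "\<forall>m\<ge>n'. r m \<notin> W' \<inter> K" using rayin_tail_avoids[OF inj fin[OF K(1)]] .
  define k where "k = max n n'"
  have av: "r m \<in> B - W'" if "m \<ge> k" for m using that n' rK rB by (auto simp: k_def)
  obtain D where D: "D \<in> comps (B - W')" "r k \<in> D" using comp_of[OF av[OF order_refl]] by blast
  have "r m \<in> D" if "m \<ge> k" for m
  proof -
    have "conn (B - W') (r k) (r m)" by (rule ray_conn_le) (use rE av that in auto)
    then show ?thesis using comps_eq[OF D] by blast
  qed
  then show ?thesis using D by blast
qed

text \<open>The clause \<open>nb B K \<inter> X = {}\<close> becomes the disjointness of separators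
  along a branch. Rays dominated from \<open>X\<close> are exempt from the last clause because they
  may stay in the part.\<close>

definition good_part :: "'a set \<Rightarrow> 'a set \<Rightarrow> 'a set \<Rightarrow> bool" where
  "good_part B X W \<longleftrightarrow> X \<subseteq> W \<and> W \<subseteq> B \<and> connd W \<and>
     (\<forall>K\<in>comps (B - W). finite (nb B K) \<and> nb B K \<inter> X = {}) \<and>
     (\<forall>r. rayin B r \<and> (\<forall>x\<in>X. \<not> domin B x r) \<longrightarrow> (\<exists>D\<in>comps (B - W). \<exists>n. \<forall>m\<ge>n. r m \<in> D))"

lemma good_part_ex:
  assumes B: "connd B" and X: "finite X" "X \<noteq> {}" "X \<subseteq> B"
  shows "\<exists>W. good_part B X W"
proof -
  define U where "U = X \<union> {y \<in> B. \<exists>x\<in>X. E x y}"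
  have "U \<subseteq> B" using X by (auto simp: U_def)
  then obtain W where W: "U \<subseteq> W" "W \<subseteq> B" "\<And>K. K \<in> comps (B - W) \<Longrightarrow> finite (nb B K)"
      "\<And>r. limray B W r \<Longrightarrow> limray B U r" using finite_adhesion_superset[of U B] by blast
  have "W \<noteq> {}" using W(1) X by (auto simp: U_def)
  then obtain W' where W': "W \<subseteq> W'" "W' \<subseteq> B" "connd W'" "\<And>K. K \<in> comps (B - W') \<Longrightarrow> finite (nb B K)"
      "\<And>K. K \<in> comps (B - W) \<Longrightarrow> finite (W' \<inter> K)" using connd_superset[OF B W(2) _ W(3)] by blast
  have "nb B K \<inter> X = {}" if K: "K \<in> comps (B - W')" for K
  proof -
    have "x \<in> U" if "E x y" "x \<in> K" "y \<in> X" for x y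
      using that E_sym comps_sub[OF K] by (auto simp: U_def)
    then show ?thesis using comps_sub[OF K] W(1) W'(1) unfolding nb_def by blast
  qed
  moreover have "\<exists>D\<in>comps (B - W'). \<exists>n. \<forall>m\<ge>n. r m \<in> D" if r: "rayin B r" "\<forall>x\<in>X. \<not> domin B x r" for r
  proof (rule ray_settles[OF r(1) _ W'(1) W'(5)])
    show "\<not> limray B W r"
    proof
      assume "limray B W r"
      then have lim: "limray B U r" by (rule W(4))
      have "\<exists>S. finite S \<and> x \<notin> S \<and> \<not> tconn B S r x" if "x \<in> X" for x
        using r(2) that unfolding domin_def by blast
      then obtain S where S: "\<And>x. x \<in> X \<Longrightarrow> finite (S x) \<and> x \<notin> S x \<and> \<not> tconn B (S x) r x" by metis
      \<comment> \<open>\<open>X\<close> itself is included so that the vertex \<open>u\<close>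
        reached off \<open>S'\<close> is a proper neighbour of some \<open>x\<close> in
        \<open>X\<close>; the edge from \<open>u\<close> to \<open>x\<close> then avoids
        \<open>S x\<close>.\<close>
      define S' where "S' = X \<union> (\<Union>x\<in>X. S x)"
      have "finite S'" using S X by (auto simp: S'_def)
      then obtain u where u: "u \<in> U" "tconn B S' r u" using lim by (auto simp: limray_def)
      have uB: "u \<in> B - S'" using tconn_in[OF u(2)] .
      then obtain x where x: "x \<in> X" "E x u" using u(1) by (auto simp: U_def S'_def)
      have "tconn B (S x) r u" by (rule tconn_mono[OF u(2)]) (use x in \<open>auto simp: S'_def\<close>)
      moreover have "conn (B - S x) u x"
        by (rule conn_step) (use x uB S[OF x(1)] X E_sym in \<open>auto simp: S'_def\<close>)
      ultimately show False using S[OF x(1)] tconn_trans by blast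
    qed
  qed
  ultimately show ?thesis unfolding good_part_def using W W' by (intro exI[of _ W']) (auto simp: U_def)
qed

end

section \<open>Equivalence and existence of rays\<close>

context sym_rel
begin

text \<open>One vertex of an \<open>S\<close>-avoiding tail of \<open>s\<close> is enough: for rays
  in \<open>V\<close>, \<open>tail_equivD\<close> extends the connection to all pairs of such
  tails.\<close>

definition tail_equiv :: "'a set \<Rightarrow> (nat \<Rightarrow> 'a) \<Rightarrow> (nat \<Rightarrow> 'a) \<Rightarrow> bool" where
  "tail_equiv V r s \<longleftrightarrow> (\<forall>S. finite S \<longrightarrow> (\<exists>n. (\<forall>m\<ge>n. s m \<notin> S) \<and> tconn V S r (s n)))"

lemma rayinD:
  assumes "rayin V r" shows "inj r" "r n \<in> V" "E (r n) (r (Suc n))"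
  using assms by (auto simp: rayin_def)

lemma tail_equivD:
  assumes eq: "tail_equiv V r s" and r: "rayin V r" and s: "rayin V s" and S: "finite S"
    and n: "\<forall>i\<ge>n. r i \<notin> S" and m: "\<forall>i\<ge>m. s i \<notin> S"
  shows "conn (V - S) (r n) (s m)"
proof -
  obtain k where k: "\<forall>i\<ge>k. s i \<notin> S" "tconn V S r (s k)" using eq S unfolding tail_equiv_def by blast
  have "conn (V - S) (r n) (s k)" by (rule tconnD[OF k(2) r n])
  moreover have "conn (V - S) (s k) (s m)"
    by (rule ray_conn[where n = "min k m"]) (use rayinD[OF s] k m in \<open>auto simp: min_le_iff_disj\<close>)
  ultimately show ?thesis by (rule conn_trans)
qed

lemma tail_equivI:
  assumes "\<And>S. finite S \<Longrightarrow> \<exists>n m. (\<forall>i\<ge>n. r i \<notin> S) \<and> (\<forall>i\<ge>m. s i \<notin> S) \<and> conn (V - S) (r n) (s m)"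
  shows "tail_equiv V r s"
  using assms unfolding tail_equiv_def tconn_def by blast

lemma tail_equiv_refl:
  assumes r: "rayin V r" shows "tail_equiv V r r"
proof (rule tail_equivI)
  fix S :: "'a set" assume "finite S"
  then obtain n where n: "\<forall>i\<ge>n. r i \<notin> S" using rayin_tail_avoids[OF rayinD(1)[OF r]] by metis
  then have "conn (V - S) (r n) (r n)" using rayinD(2)[OF r] by (auto intro: conn_refl)
  then show "\<exists>n m. (\<forall>i\<ge>n. r i \<notin> S) \<and> (\<forall>i\<ge>m. r i \<notin> S) \<and> conn (V - S) (r n) (r m)" using n by blast
qed

lemma tail_equiv_sym:
  assumes "tail_equiv V r s" "rayin V r" "rayin V s" shows "tail_equiv V s r"
proof (rule tail_equivI)
  fix S :: "'a set" assume S: "finite S"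
  obtain n where n: "\<forall>i\<ge>n. r i \<notin> S" using rayin_tail_avoids[OF rayinD(1)[OF assms(2)] S] .
  obtain m where m: "\<forall>i\<ge>m. s i \<notin> S" using rayin_tail_avoids[OF rayinD(1)[OF assms(3)] S] .
  show "\<exists>n m. (\<forall>i\<ge>n. s i \<notin> S) \<and> (\<forall>i\<ge>m. r i \<notin> S) \<and> conn (V - S) (s n) (r m)"
    using conn_sym[OF tail_equivD[OF assms S n m]] n m by blast
qed

lemma tail_equiv_trans:
  assumes "tail_equiv V r s" "tail_equiv V s t" "rayin V r" "rayin V s" "rayin V t"
  shows "tail_equiv V r t"
proof (rule tail_equivI)
  fix S :: "'a set" assume S: "finite S"
  obtain n where n: "\<forall>i\<ge>n. r i \<notin> S" using rayin_tail_avoids[OF rayinD(1)[OF assms(3)] S] .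
  obtain m where m: "\<forall>i\<ge>m. s i \<notin> S" using rayin_tail_avoids[OF rayinD(1)[OF assms(4)] S] .
  obtain k where k: "\<forall>i\<ge>k. t i \<notin> S" using rayin_tail_avoids[OF rayinD(1)[OF assms(5)] S] .
  show "\<exists>n m. (\<forall>i\<ge>n. r i \<notin> S) \<and> (\<forall>i\<ge>m. t i \<notin> S) \<and> conn (V - S) (r n) (t m)"
    using conn_trans[OF tail_equivD[OF assms(1,3,4) S n m] tail_equivD[OF assms(2,4,5) S m k]] n k by blast
qed

text \<open>No walk off the finite set \<open>nb V D\<close> leaves \<open>D\<close>, and off this
  set a tail of \<open>s\<close> is joined to a vertex of \<open>r\<close> in
  \<open>D\<close>.\<close>

lemma tail_equiv_has_tail:
  assumes eq: "tail_equiv V r s" and r: "rayin V r" and s: "rayin V s"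
    and fin: "finite (nb V D)" and tail: "has_tail_in r D"
  shows "has_tail_in s D"
proof -
  obtain n1 where n1: "\<forall>i\<ge>n1. r i \<notin> nb V D" using rayin_tail_avoids[OF rayinD(1)[OF r] fin] .
  obtain n2 where n2: "\<forall>i\<ge>n2. r i \<in> D" using tail by (auto simp: has_tail_in_def)
  obtain m where m: "\<forall>i\<ge>m. s i \<notin> nb V D" using rayin_tail_avoids[OF rayinD(1)[OF s] fin] .
  define n where "n = max n1 n2"
  have "s i \<in> D" if "i \<ge> m" for i
  proof (rule conn_stays)
    show "conn (V - nb V D) (r n) (s i)"
      by (rule tail_equivD[OF eq r s fin]) (use n1 m that in \<open>auto simp: n_def\<close>)
    show "r n \<in> D" using n2 by (simp add: n_def)
  qed (auto simp: nb_def)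
  then show ?thesis by (auto simp: has_tail_in_def)
qed

text \<open>Loop erasure by last visits: from the last visit to a vertex the walk moves on to a new
  vertex, and the next index is the last visit to that one.\<close>

lemma ray_of_lazy_walk:
  fixes w :: "nat \<Rightarrow> 'a"
  assumes step: "\<And>n. w (Suc n) = w n \<or> E (w n) (w (Suc n))"
    and fin: "\<And>v. finite {n. w n = v}"
  shows "\<exists>f. strict_mono f \<and> inj (\<lambda>k. w (f k)) \<and> (\<forall>k. E (w (f k)) (w (f (Suc k))))"
proof -
  define l where "l n = Max {m. w m = w n}" for n
  have l: "w (l n) = w n" for n using Max_in[OF fin, of "w n"] by (auto simp: l_def)
  have le: "m \<le> l n" if "w m = w n" for m n using Max_ge[OF fin, of m "w n"] that by (simp add: l_def)
  define f where "f = rec_nat (l 0) (\<lambda>_ m. l (Suc m))"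
  have f: "f 0 = l 0" "f (Suc k) = l (Suc (f k))" for k by (simp_all add: f_def)
  have ll: "l (l n) = l n" for n unfolding l_def using l[unfolded l_def] by simp
  have lf: "l (f k) = f k" for k by (cases k) (simp_all add: f ll)
  have mono: "strict_mono f" unfolding strict_mono_Suc_iff
    using le[of "Suc (f n)" "Suc (f n)" for n] by (simp add: f Suc_le_lessD)
  have neq: "w (f j) \<noteq> w (f k)" if "j < k" for j k
    using le[of "f k" "f j"] lf[of j] strict_monoD[OF mono that] by auto
  have "inj (\<lambda>k. w (f k))" by (rule injI) (metis neq linorder_neqE_nat)
  moreover have "E (w (f k)) (w (f (Suc k)))" for k
    using step[of "f k"] le[of "Suc (f k)" "f k"] lf[of k] l by (auto simp: f)
  ultimately show ?thesis using mono by blast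
qed

text \<open>Points \<open>x i\<close> of the sets are joined successively, from \<open>x i\<close>
  to \<open>x (Suc i)\<close> inside \<open>C i\<close>, by shortest paths. Each vertex is missing
  from some \<open>C i\<close>, hence visited finitely often, and loop erasure gives the
  ray.\<close>

lemma ray_of_nested_connd:
  assumes dec: "\<And>i. C (Suc i) \<subseteq> C i" and con: "\<And>i. connd (C i)" and ne: "\<And>i. C i \<noteq> {}"
    and empty: "\<And>v. \<exists>i. v \<notin> C i"
  shows "\<exists>r. rayin (C 0) r \<and> (\<forall>i. has_tail_in r (C i))"
proof -
  have anti: "C j \<subseteq> C i" if "i \<le> j" for i j
    using that by (induction rule: dec_induct) (use dec in auto)
  have "\<forall>i. \<exists>y. y \<in> C i" using ne by blast
  then obtain x where x: "\<And>i. x i \<in> C i" by metis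
  let ?R = "\<lambda>i u v. E u v \<and> u \<in> C i \<and> v \<in> C i"
  define d where "d i v = (LEAST n. (?R i ^^ n) v (x (Suc i)))" for i v
  have ex: "\<exists>n. (?R i ^^ n) v (x (Suc i))" if "v \<in> C i" for i v
  proof -
    have "conn (C i) v (x (Suc i))" by (rule conndD[OF con that]) (use x[of "Suc i"] dec in blast)
    then show ?thesis unfolding conn_def by (simp add: rtranclp_power)
  qed
  have closer: "\<exists>u. E v u \<and> u \<in> C i \<and> d i u < d i v" if v: "v \<in> C i" "v \<noteq> x (Suc i)" for i v
  proof -
    have dv: "(?R i ^^ d i v) v (x (Suc i))" unfolding d_def by (rule LeastI_ex[OF ex[OF v(1)]])
    then obtain n where n: "d i v = Suc n" using v(2) by (cases "d i v") auto
    then obtain u where u: "?R i v u" "(?R i ^^ n) u (x (Suc i))"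
      using relpowp_Suc_D2[OF dv[unfolded n]] by blast
    then have "d i u \<le> n" unfolding d_def by (intro Least_le)
    then show ?thesis using u n by auto
  qed
  define g where "g i v = (SOME u. E v u \<and> u \<in> C i \<and> d i u < d i v)" for i v
  have g: "E v (g i v) \<and> g i v \<in> C i \<and> d i (g i v) < d i v" if "v \<in> C i" "v \<noteq> x (Suc i)" for i v
    unfolding g_def by (rule someI_ex[OF closer[OF that]])
  \<comment> \<open>A state is a level with a current vertex. At the target \<open>x (Suc i)\<close>
    only the level rises and the vertex is repeated; this is why the walk is lazy.\<close>
  define nxt where "nxt = (\<lambda>(i, v). if v = x (Suc i) then (Suc i, v) else (i, g i v))"
  define st where "st n = (nxt ^^ n) (0, x 0)" for n
  have st: "st 0 = (0, x 0)" "st (Suc n) = nxt (st n)" for n by (simp_all add: st_def)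
  define lev where "lev n = fst (st n)" for n
  define w where "w n = snd (st n)" for n
  have stp: "st n = (lev n, w n)" for n by (simp add: lev_def w_def)
  have s1: "lev (Suc n) = Suc (lev n) \<and> w (Suc n) = w n" if "w n = x (Suc (lev n))" for n
    using st(2)[of n] that by (simp add: stp nxt_def)
  have s2: "lev (Suc n) = lev n \<and> w (Suc n) = g (lev n) (w n)" if "w n \<noteq> x (Suc (lev n))" for n
    using st(2)[of n] that by (simp add: stp nxt_def)
  have wC: "w n \<in> C (lev n)" for n
  proof (induction n)
    case 0 then show ?case using x by (simp add: lev_def w_def st)
  next
    case (Suc n) show ?case
    proof (cases "w n = x (Suc (lev n))")
      case True then show ?thesis using s1[OF True] x by simp
    next
      case False then show ?thesis using s2[OF False] g[OF Suc False] by simp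
    qed
  qed
  have step: "w (Suc n) = w n \<or> E (w n) (w (Suc n))" for n
    using s1[of n] s2[of n] g[OF wC, of n] by metis
  have mono: "mono lev" unfolding mono_iff_le_Suc using s1 s2 by (metis le_SucI order_refl)
  \<comment> \<open>Each step at a fixed level brings the walk closer to its target, so the level
    eventually rises.\<close>
  have adv: "\<exists>m>n. lev m = Suc (lev n)" for n
  proof (induction "d (lev n) (w n)" arbitrary: n rule: less_induct)
    case less
    show ?case
    proof (cases "w n = x (Suc (lev n))")
      case True then show ?thesis using s1[OF True] by blast
    next
      case False
      then have "d (lev (Suc n)) (w (Suc n)) < d (lev n) (w n)" using s2[OF False] g[OF wC False] by simp
      then obtain m where "m > Suc n" "lev m = Suc (lev (Suc n))" using less by blast
      then show ?thesis using s2[OF False] by (intro exI[of _ m]) auto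
    qed
  qed
  have lev_unb: "\<exists>n. lev n = i" for i
  proof (induction i)
    case 0 then show ?case by (intro exI[of _ 0]) (simp add: lev_def st)
  next
    case (Suc i) then show ?case using adv by metis
  qed
  have tail: "\<exists>n. \<forall>m\<ge>n. w m \<in> C i" for i
  proof -
    obtain n where n: "lev n = i" using lev_unb by blast
    have "w m \<in> C i" if "m \<ge> n" for m
      using wC[of m] anti[of i "lev m"] monoD[OF mono that] n by auto
    then show ?thesis by blast
  qed
  have "finite {n. w n = v}" for v
  proof -
    obtain i where i: "v \<notin> C i" using empty by blast
    obtain n where n: "\<forall>m\<ge>n. w m \<in> C i" using tail by blast
    have "m < n" if "w m = v" for m using that n i not_less by blast
    then have "{n. w n = v} \<subseteq> {..<n}" by auto
    then show ?thesis by (rule finite_subset) simp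
  qed
  from ray_of_lazy_walk[of w, OF step this] obtain f where
    f: "strict_mono f" "inj (\<lambda>k. w (f k))" "\<And>k. E (w (f k)) (w (f (Suc k)))" by blast
  have "w n \<in> C 0" for n using wC[of n] anti[of 0 "lev n"] by auto
  then have "rayin (C 0) (\<lambda>k. w (f k))" unfolding rayin_def using f by auto
  moreover have "has_tail_in (\<lambda>k. w (f k)) (C i)" for i
  proof -
    obtain n where "\<forall>m\<ge>n. w m \<in> C i" using tail by blast
    moreover have "m \<le> f m" for m using strict_mono_imp_increasing[OF f(1)] .
    ultimately show ?thesis unfolding has_tail_in_def by (meson order_trans)
  qed
  ultimately show ?thesis by blast
qed

end

section \<open>Ends of bidirected graphs\<close>

locale bidirected_graph =
  fixes G :: "'a pair_pre_digraph"
  assumes bidirected: "pair_bidirected_digraph G"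

sublocale bidirected_graph \<subseteq> sym_rel "\<lambda>x y. (x, y) \<in> parcs G"
proof
  interpret pair_bidirected_digraph G by (rule bidirected)
  show "(y, x) \<in> parcs G" if "(x, y) \<in> parcs G" for x y
    using pair_sym_arcs that by (auto simp: symmetric_def dest: symD)
qed

context bidirected_graph
begin

section \<open>Library connectivity and ends in terms of the relation of adjacency\<close>

lemma arc_in_verts: "(x, y) \<in> parcs G \<Longrightarrow> x \<in> pverts G \<and> y \<in> pverts G"
proof -
  interpret pair_bidirected_digraph G by (rule bidirected)
  show "(x, y) \<in> parcs G \<Longrightarrow> x \<in> pverts G \<and> y \<in> pverts G"
    using arc_fst_in_verts arc_snd_in_verts by fastforce
qed

lemma arcs_ends_induced: "arcs_ends (with_proj G \<restriction> B) = {(x, y). (x, y) \<in> parcs G \<and> x \<in> B \<and> y \<in> B}"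
  by (auto simp: arcs_ends_conv)

lemma reachable_induced_iff: "a \<rightarrow>\<^sup>*\<^bsub>with_proj G \<restriction> B\<^esub> b \<longleftrightarrow> conn B a b"
proof
  assume "a \<rightarrow>\<^sup>*\<^bsub>with_proj G \<restriction> B\<^esub> b"
  then have "(a, b) \<in> rtrancl_on B {(x, y). (x, y) \<in> parcs G \<and> x \<in> B \<and> y \<in> B}"
    by (simp add: reachable_def arcs_ends_induced)
  then show "conn B a b"
  proof (induction rule: rtrancl_on_induct)
    case base then show ?case by (rule conn_refl)
  next
    case (step y z) then show ?case using conn_trans conn_step[of y z B] by blast
  qed
next
  assume "conn B a b"
  then have "(a, b) \<in> rtrancl_on B {(x, y). (x, y) \<in> parcs G \<and> x \<in> B \<and> y \<in> B}"
  proof (induction rule: conn_induct)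
    case base then show ?case using conn_in(1)[OF \<open>conn B a b\<close>] by (rule rtrancl_on_refl)
  next
    case (step x y)
    show ?case by (rule rtrancl_on_into_rtrancl_on[OF step(5)]) (use step in auto)
  qed
  then show "a \<rightarrow>\<^sup>*\<^bsub>with_proj G \<restriction> B\<^esub> b" by (simp add: reachable_def arcs_ends_induced)
qed

text \<open>\<open>connected\<close> refers to the symmetric closure. As arcs come in opposite
  pairs, passing to it does not change reachability.\<close>

lemma connected_induced_iff: "connected (with_proj G \<restriction> B) \<longleftrightarrow> B \<noteq> {} \<and> connd B"
proof -
  have sym: "symmetric (with_proj G \<restriction> B)"
    using E_sym by (auto simp: symmetric_def arcs_ends_induced sym_def)
  have wf: "wf_digraph (with_proj G \<restriction> B)" by unfold_locales auto
  have "u \<rightarrow>\<^sup>*\<^bsub>with_proj (mk_symmetric (with_proj G \<restriction> B))\<^esub> v \<longleftrightarrow> conn B u v" for u v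
    unfolding wf_digraph.reachable_mk_symmetric_eq[OF wf sym] by (rule reachable_induced_iff)
  then show ?thesis by (auto simp: connected_def strongly_connected_def connd_def reachable_induced_iff)
qed

lemma induced_pverts: "with_proj G \<restriction> pverts G = with_proj G"
  using arc_in_verts by (auto simp: induce_subgraph_def with_proj_def)

lemma connected_iff: "connected (with_proj G) \<longleftrightarrow> pverts G \<noteq> {} \<and> connd (pverts G)"
  using connected_induced_iff[of "pverts G"] by (simp only: induced_pverts)

lemma sccs_verts_superset:
  assumes "D \<noteq> {}" "connd D" "D \<subseteq> B"
  shows "\<exists>C \<in> pre_digraph.sccs_verts (with_proj G \<restriction> B). D \<subseteq> C"
proof -
  obtain a where a: "a \<in> D" using assms by blast
  then obtain C where C: "C \<in> comps B" "a \<in> C" using comp_of[of a B] assms by blast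
  have "D \<subseteq> C" by (rule connd_in_comp[OF assms(2,3) C(1) a C(2)])
  moreover have "conn B u v" if "u \<in> C" "v \<in> C" for u v using comps_eq[OF C(1) that(1)] that(2) by blast
  moreover have "\<not> conn B u v" if "u \<in> C" "v \<notin> C" for u v using comps_eq[OF C(1) that(1)] that(2) by blast
  ultimately show ?thesis using C(2)
    by (intro bexI[of _ C]) (auto simp: pre_digraph.sccs_verts_def reachable_induced_iff)
qed

lemma sccs_verts_sub:
  assumes "C \<in> pre_digraph.sccs_verts (with_proj G \<restriction> B)" shows "C \<subseteq> B"
proof
  fix u assume "u \<in> C"
  then have "conn B u u" using assms by (auto simp: pre_digraph.sccs_verts_def reachable_induced_iff)
  then show "u \<in> B" by (rule conn_in)
qed

lemma ray_iff: "ray G r \<longleftrightarrow> rayin (pverts G) r"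
  using arc_in_verts by (auto simp: ray_def rayin_def)

lemma equivalent_rays_iff:
  assumes r: "rayin (pverts G) r" and s: "rayin (pverts G) s"
  shows "equivalent_rays G r s \<longleftrightarrow> tail_equiv (pverts G) r s"
proof
  assume eq: "equivalent_rays G r s"
  show "tail_equiv (pverts G) r s"
  proof (rule tail_equivI)
    fix S :: "'a set" assume S: "finite S"
    obtain n where n: "\<forall>i\<ge>n. r i \<notin> S" using rayin_tail_avoids[OF rayinD(1)[OF r] S] .
    obtain m where m: "\<forall>i\<ge>m. s i \<notin> S" using rayin_tail_avoids[OF rayinD(1)[OF s] S] .
    \<comment> \<open>\<open>equivalent_rays\<close> speaks of whole rays, \<open>tail_equiv\<close>
      of tails. Deleting the initial segments before \<open>n\<close> and \<open>m\<close> as well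
      forces the connection to start and end on the tails.\<close>
    define X where "X = (S \<inter> pverts G) \<union> r ` {..<n} \<union> s ` {..<m}"
    have X: "finite X" "X \<subseteq> pverts G" using S rayinD(2)[OF r] rayinD(2)[OF s] by (auto simp: X_def)
    then obtain i j where ij: "conn (pverts G - X) (r i) (s j)"
      using eq by (auto simp: equivalent_rays_def separates_def reachable_induced_iff)
    have "r i \<notin> X" "s j \<notin> X" using conn_in[OF ij] by auto
    then have "i \<ge> n" "j \<ge> m" by (auto simp: X_def not_less[symmetric])
    moreover have "conn (pverts G - S) (r i) (s j)" by (rule conn_mono[OF ij]) (auto simp: X_def)
    ultimately show "\<exists>n m. (\<forall>i\<ge>n. r i \<notin> S) \<and> (\<forall>i\<ge>m. s i \<notin> S) \<and> conn (pverts G - S) (r n) (s m)"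
      using n m by (meson order_trans)
  qed
next
  assume eq: "tail_equiv (pverts G) r s"
  have "\<not> separates G X (range r) (range s)" if X: "finite X" for X
  proof -
    obtain m where "tconn (pverts G) X r (s m)" using eq X by (auto simp: tail_equiv_def)
    then obtain n where "conn (pverts G - X) (r n) (s m)" by (auto simp: tconn_def)
    then show ?thesis by (auto simp: separates_def reachable_induced_iff)
  qed
  then show "equivalent_rays G r s" unfolding equivalent_rays_def by blast
qed

definition ray_class :: "(nat \<Rightarrow> 'a) \<Rightarrow> (nat \<Rightarrow> 'a) set" where
  "ray_class r = {s. rayin (pverts G) s \<and> tail_equiv (pverts G) r s}"

lemma ends_eq: "ends G = ray_class ` {r. rayin (pverts G) r}"
proof -
  have "{(r, s). ray G r \<and> ray G s \<and> equivalent_rays G r s} `` {r} = ray_class r" if "rayin (pverts G) r" for r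
    using that by (auto simp: ray_class_def ray_iff equivalent_rays_iff)
  then show ?thesis unfolding ends_def quotient_def ray_iff by force
qed

lemma ray_class_self: "rayin (pverts G) r \<Longrightarrow> r \<in> ray_class r"
  by (simp add: ray_class_def tail_equiv_refl)

lemma ray_class_eqI:
  assumes "rayin (pverts G) r" "rayin (pverts G) s" "tail_equiv (pverts G) r s"
  shows "ray_class r = ray_class s"
  unfolding ray_class_def
  using tail_equiv_trans[OF tail_equiv_sym[OF assms(3,1,2)]] tail_equiv_trans[OF assms(3)] assms by blast

lemma end_tails:
  assumes "rayin (pverts G) r" "has_tail_in r D" "finite (nb (pverts G) D)" "s \<in> ray_class r"
  shows "has_tail_in s D"
  using assms tail_equiv_has_tail[of "pverts G" r s D] by (auto simp: ray_class_def)

section \<open>Domination of ends\<close>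

lemma vwalk_leaves:
  assumes "set (vwalk_arcs p) \<subseteq> parcs G" "p \<noteq> []" "hd p \<notin> D" "last p \<in> D"
  shows "\<exists>y\<in>set p. y \<in> nb (pverts G) D"
  using assms
proof (induction p rule: vwalk_arcs.induct)
  case (3 x y xs)
  show ?case
  proof (cases "y \<in> D")
    case True
    then have "x \<in> nb (pverts G) D" using 3 arc_in_verts[of x y] E_sym by (auto simp: nb_def)
    then show ?thesis by auto
  next
    case False then show ?thesis using 3 by auto
  qed
qed auto

lemma conn_vpath:
  assumes "conn B a b" "B \<subseteq> pverts G"
  shows "\<exists>p. vpath p (with_proj G) \<and> hd p = a \<and> last p = b \<and> set p \<subseteq> B"
  using assms(1)
proof (induction rule: conn_induct)
  case base
  then show ?case using conn_in(1)[OF assms(1)] assms(2)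
    by (intro exI[of _ "[a]"]) (auto simp: vpath_def vwalk_def)
next
  case (step x y)
  then obtain p where p: "vpath p (with_proj G)" "hd p = a" "last p = x" "set p \<subseteq> B" by blast
  then have pa: "set (vwalk_arcs p) \<subseteq> parcs G" "p \<noteq> []" "distinct p" by (auto simp: vpath_def vwalk_def)
  show ?case
  proof (cases "y \<in> set p")
    case True
    then obtain p1 p2 where s: "p = (p1 @ [y]) @ p2" by (auto dest: split_list)
    have "set (vwalk_arcs (p1 @ [y])) \<subseteq> set (vwalk_arcs p)"
      unfolding s by (cases p2) (auto simp: vwalk_arcs_append simp del: append_assoc)
    moreover have "hd (p1 @ [y]) = a" using p(2) s by (cases p1) auto
    ultimately show ?thesis using p pa s assms(2)
      by (intro exI[of _ "p1 @ [y]"]) (auto simp: vpath_def vwalk_def)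
  next
    case False
    have "vwalk_arcs (p @ [y]) = vwalk_arcs p @ [(x, y)]" using vwalk_arcs_append[of p "[y]"] pa p by simp
    then show ?thesis using p pa step False assms(2)
      by (intro exI[of _ "p @ [y]"]) (auto simp: vpath_def vwalk_def)
  qed
qed

text \<open>The star is built greedily: the paths found so far, without their centre, form a finite
  set that does not contain \<open>x\<close>, so a further path to the ray avoids them.\<close>

lemma domin_imp_dominates_end:
  assumes r: "rayin (pverts G) r" and dom: "domin (pverts G) x r" and \<epsilon>: "r \<in> \<epsilon>"
  shows "dominates_end G x \<epsilon>"
proof -
  define ok where "ok p S \<longleftrightarrow> vpath p (with_proj G) \<and> hd p = x \<and> last p \<in> range r \<and> last p \<noteq> x \<and> set p \<inter> S = {}" for p S
  have ex: "\<exists>p. ok p S" if S: "finite S" "x \<notin> S" for S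
  proof -
    have "tconn (pverts G) S r x" using dom S by (auto simp: domin_def)
    then obtain n where n: "\<forall>m\<ge>n. r m \<notin> S" "conn (pverts G - S) (r n) x" by (auto simp: tconn_def)
    \<comment> \<open>Two consecutive vertices are considered because \<open>x\<close> may lie on
      the ray; at least one of them differs from \<open>x\<close> and can serve as a leaf.\<close>
    have "conn (pverts G - S) (r n) (r (Suc n))"
      by (rule conn_step) (use n rayinD[OF r] in auto)
    then have "conn (pverts G - S) x (r n)" "conn (pverts G - S) x (r (Suc n))"
      using n conn_sym conn_trans by blast+
    moreover have "r n \<noteq> x \<or> r (Suc n) \<noteq> x" using injD[OF rayinD(1)[OF r], of n "Suc n"] by auto
    ultimately obtain k where k: "r k \<noteq> x" "conn (pverts G - S) x (r k)" by blast
    obtain p where "vpath p (with_proj G)" "hd p = x" "last p = r k" "set p \<subseteq> pverts G - S"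
      using conn_vpath[OF k(2)] by blast
    then have "ok p S" using k by (auto simp: ok_def)
    then show ?thesis ..
  qed
  \<comment> \<open>The second component of \<open>q n\<close> accumulates the vertices other than
    \<open>x\<close> of all earlier paths.\<close>
  have "\<exists>q. \<forall>n. (finite (snd (q n)) \<and> x \<notin> snd (q n) \<and> ok (fst (q n)) (snd (q n))) \<and>
      snd (q (Suc n)) = snd (q n) \<union> (set (fst (q n)) - {x})"
  proof (rule dependent_nat_choice)
    obtain p where "ok p {}" using ex[of "{}"] by auto
    then show "\<exists>q. finite (snd q) \<and> x \<notin> snd q \<and> ok (fst q) (snd q)" by (intro exI[of _ "(p, {})"]) auto
  next
    fix q n assume q: "finite (snd q) \<and> x \<notin> snd q \<and> ok (fst q) (snd q)"
    let ?S = "snd q \<union> (set (fst q) - {x})"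
    obtain p where "ok p ?S" using ex[of ?S] q by auto
    then show "\<exists>y. (finite (snd y) \<and> x \<notin> snd y \<and> ok (fst y) (snd y)) \<and> snd y = ?S"
      using q by (intro exI[of _ "(p, ?S)"]) auto
  qed
  then obtain q where q: "\<And>n. ok (fst (q n)) (snd (q n))" "\<And>n. snd (q (Suc n)) = snd (q n) \<union> (set (fst (q n)) - {x})"
    by blast
  define P where "P n = fst (q n)" for n
  have P: "vpath (P n) (with_proj G)" "hd (P n) = x" "last (P n) \<in> range r" "last (P n) \<noteq> x" for n
    using q(1)[of n] by (auto simp: ok_def P_def)
  have xP: "x \<in> set (P n)" for n using P(1,2)[of n] by (auto simp: vpath_def vwalk_def)
  have acc: "set (P m) - {x} \<subseteq> snd (q n)" if "m < n" for m n
    using that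
  proof (induction n)
    case (Suc n) then show ?case using q(2)[of n] less_Suc_eq[of m n] by (auto simp: P_def)
  qed simp
  have lt: "set (P m) \<inter> set (P n) = {x}" if "m < n" for m n
    using acc[OF that] q(1)[of n] xP[of m] xP[of n] by (auto simp: ok_def P_def)
  then have "set (P m) \<inter> set (P n) = {x}" if "m \<noteq> n" for m n
    using that linorder_neqE_nat[of m n] lt[of m n] lt[of n m] by blast
  then have "subdivided_star G x P" using P by (auto simp: subdivided_star_def)
  then show ?thesis using P(3) \<epsilon> unfolding dominates_end_def by blast
qed

text \<open>The leaves of a star are distinct, so all but finitely many lie in \<open>D\<close>. The
  paths to them start outside \<open>D\<close> and cross \<open>nb (pverts G) D\<close> in vertices
  other than \<open>v\<close>; these are distinct for distinct paths, against finiteness.\<close>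

lemma not_dominated:
  assumes fin: "finite (nb (pverts G) D)" and v: "v \<notin> D" "v \<notin> nb (pverts G) D"
    and tail: "\<And>r. r \<in> \<epsilon> \<Longrightarrow> has_tail_in r D"
  shows "\<not> dominates_end G v \<epsilon>"
proof
  assume "dominates_end G v \<epsilon>"
  then obtain P r where P: "subdivided_star G v P" and r: "r \<in> \<epsilon>" "\<And>n. last (P n) \<in> range r"
    by (auto simp: dominates_end_def)
  have p: "set (vwalk_arcs (P n)) \<subseteq> parcs G" "P n \<noteq> []" "hd (P n) = v" "last (P n) \<noteq> v" for n
    using P by (auto simp: subdivided_star_def vpath_def vwalk_def)
  have dis: "set (P m) \<inter> set (P n) = {v}" if "m \<noteq> n" for m n using P that by (auto simp: subdivided_star_def)
  obtain k where k: "\<forall>m\<ge>k. r m \<in> D" using tail[OF r(1)] by (auto simp: has_tail_in_def)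
  let ?I = "{n. last (P n) \<in> D}"
  have lastP: "last (P n) \<in> set (P n)" for n using p(2) by simp
  have inj: "m = n" if "last (P m) = last (P n)" for m n
    using dis[of m n] lastP[of m] lastP[of n] p(4)[of n] that by (metis IntI singletonD)
  have "finite (- ?I)"
  proof (rule inj_on_finite)
    show "inj_on (\<lambda>n. last (P n)) (- ?I)" by (rule inj_onI) (rule inj)
    show "(\<lambda>n. last (P n)) ` (- ?I) \<subseteq> r ` {..<k}"
    proof
      fix y assume "y \<in> (\<lambda>n. last (P n)) ` (- ?I)"
      then obtain n where n: "y = last (P n)" "y \<notin> D" by auto
      then obtain m where "y = r m" using r(2)[of n] by auto
      then show "y \<in> r ` {..<k}" using n k by (auto simp: not_less[symmetric])
    qed
  qed simp
  then have infI: "infinite ?I" by (metis Compl_eq_Diff_UNIV Diff_infinite_finite infinite_UNIV_nat double_complement)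
  have "\<exists>y\<in>set (P n). y \<in> nb (pverts G) D" if "n \<in> ?I" for n
    by (rule vwalk_leaves) (use p v that in auto)
  then obtain f where f: "\<And>n. n \<in> ?I \<Longrightarrow> f n \<in> set (P n) \<and> f n \<in> nb (pverts G) D" by metis
  have "inj_on f ?I"
  proof (rule inj_onI, rule ccontr)
    fix m n assume "m \<in> ?I" "n \<in> ?I" "f m = f n" "m \<noteq> n"
    then have "f n = v" using f[of m] f[of n] dis[of m n] by (metis IntI singletonD)
    then show False using f \<open>n \<in> ?I\<close> v by blast
  qed
  then have "finite ?I" by (rule inj_on_finite[OF _ _ fin]) (use f in blast)
  then show False using infI by blast
qed

end

section \<open>The tree of regions\<close>

text \<open>The bookkeeping on \<open>i\<close> is the point: the exit vertex is reached strictly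
  before step \<open>n\<close> unless it is \<open>b\<close> itself. This is the decreasing measure
  of \<open>parts_cover_zone\<close>.\<close>

lemma relpowp_exit:
  assumes "(E ^^ n) v b" "v \<in> D"
  shows "b \<in> D \<or> (\<exists>i x y. (E ^^ i) v y \<and> x \<in> D \<and> y \<notin> D \<and> E x y \<and> (i < n \<or> i = n \<and> y = b))"
  using assms(1)
proof (induction n arbitrary: b)
  case 0 then show ?case using assms(2) by simp
next
  case (Suc n)
  then obtain c where c: "(E ^^ n) v c" "E c b" by auto
  show ?case
  proof (cases "c \<in> D")
    case True then show ?thesis using Suc.prems c by blast
  next
    case False
    then show ?thesis using Suc.IH[OF c(1)] less_Suc_eq by blast
  qed
qed

text \<open>Nodes will be lists and ancestors suffixes, so this says that two nodes are comparable
  or lie above two different children of a common node \<open>c\<close>.\<close>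

lemma suffix_trichotomy:
  "suffix s t \<or> suffix t s \<or>
    (\<exists>u a c u' a'. s = u @ a # c \<and> t = u' @ a' # c \<and> a \<noteq> a')"
proof (induction s)
  case Nil then show ?case by simp
next
  case (Cons a s)
  consider "suffix s t" | "suffix t s"
    | "\<exists>u b c u' b'. s = u @ b # c \<and> t = u' @ b' # c \<and> b \<noteq> b'" using Cons by blast
  then show ?case
  proof cases
    case 1
    then obtain v where v: "t = v @ s" by (auto simp: suffix_def)
    show ?thesis
    proof (cases v rule: rev_cases)
      case Nil then show ?thesis using v by (simp add: suffix_Cons)
    next
      case (snoc v' a')
      show ?thesis
      proof (cases "a = a'")
        case True then show ?thesis using v snoc by (simp add: suffix_def)
      next
        case False
        then have "a # s = [] @ a # s \<and> t = v' @ a' # s \<and> a \<noteq> a'" using v snoc by simp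
        then show ?thesis by blast
      qed
    qed
  next
    case 2 then show ?thesis by (simp add: suffix_Cons)
  next
    case 3
    then obtain u b c u' b' where "s = u @ b # c" "t = u' @ b' # c" "b \<noteq> b'" by blast
    then have "a # s = (a # u) @ b # c \<and> t = u' @ b' # c \<and> b \<noteq> b'" by simp
    then show ?thesis by blast
  qed
qed

locale rooted_graph = sym_rel E for E :: "'a \<Rightarrow> 'a \<Rightarrow> bool" +
  fixes Vg :: "'a set" and z0 :: 'a
  assumes connd_Vg: "connd Vg" and z0: "z0 \<in> Vg" and E_in: "E x y \<Longrightarrow> x \<in> Vg \<and> y \<in> Vg"
begin

text \<open>A node is the list of the regions on the path from it to the root, whose own region, the whole
  vertex set, is left out.  The root gets the arbitrary boundary \<open>{z0}\<close>.\<close>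

primrec region :: "'a set list \<Rightarrow> 'a set" where
  "region [] = Vg"
| "region (D # t) = D"

primrec bd :: "'a set list \<Rightarrow> 'a set" where
  "bd [] = {z0}"
| "bd (D # t) = nb Vg D"

text \<open>The part of \<open>t\<close> is chosen here and contains \<open>bd t\<close>. For a node
  other than the root this is its overlap with the parent part; inside the region alone the two
  would be disjoint.\<close>

definition zone :: "'a set list \<Rightarrow> 'a set" where
  "zone t = region t \<union> bd t"

definition part :: "'a set list \<Rightarrow> 'a set" where
  "part t = (SOME W. good_part (zone t) (bd t) W)"

inductive_set nodes :: "'a set list set" where
  root: "[] \<in> nodes"
| child: "t \<in> nodes \<Longrightarrow> D \<in> comps (zone t - part t) \<Longrightarrow> D # t \<in> nodes"

lemma zone_simps: "zone [] = Vg" "zone (D # t) = D \<union> nb Vg D"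
  using z0 by (auto simp: zone_def)

text \<open>This contains what \<open>good_part_ex\<close> needs; connectedness of the zone follows
  from that of the region.\<close>

definition node_ok :: "'a set list \<Rightarrow> bool" where
  "node_ok t \<longleftrightarrow> region t \<subseteq> Vg \<and> region t \<noteq> {} \<and> connd (region t) \<and> finite (bd t) \<and> bd t \<noteq> {}"

lemma node_ok_good_part:
  assumes "node_ok t" shows "good_part (zone t) (bd t) (part t)"
proof -
  have "connd (zone t)"
    using assms connd_Vg connd_with_nb by (cases t) (auto simp: node_ok_def zone_simps)
  then show ?thesis unfolding part_def
    by (intro someI_ex[OF good_part_ex]) (use assms in \<open>auto simp: node_ok_def zone_def\<close>)
qed

lemma bd_sub: "bd t \<subseteq> Vg"
  using z0 by (cases t) (auto simp: nb_def)

lemma node_ok_child: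
  assumes t: "node_ok t" and D: "D \<in> comps (zone t - part t)"
  shows "D \<subseteq> region t" "D \<inter> part t = {}" "nb Vg D \<subseteq> part t" "nb Vg D \<subseteq> region t"
    "nb Vg D \<inter> bd t = {}" "node_ok (D # t)"
proof -
  note gp = node_ok_good_part[OF t]
  have gp': "bd t \<subseteq> part t" "part t \<subseteq> zone t" "finite (nb (zone t) D)" "nb (zone t) D \<inter> bd t = {}"
    using gp D by (auto simp: good_part_def)
  have DH: "D \<subseteq> zone t - part t" by (rule comps_sub[OF D])
  then show DR: "D \<subseteq> region t" and "D \<inter> part t = {}" using gp' by (auto simp: zone_def)
  have hV: "zone t \<subseteq> Vg" using t bd_sub by (auto simp: node_ok_def zone_def)
  \<comment> \<open>All neighbours of a region lie in its zone, so the neighbourhoods of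
    \<open>D\<close> in the zone and in the whole graph coincide.\<close>
  have "y \<in> zone t" if "y \<in> Vg - D" "x \<in> D" "E x y" for x y
    using that DR by (cases t) (auto simp: zone_simps nb_def)
  then have nbeq: "nb Vg D = nb (zone t) D" using hV by (auto simp: nb_def)
  show nbp: "nb Vg D \<subseteq> part t" unfolding nbeq by (rule nb_comp_sub[OF D])
  show nbb: "nb Vg D \<inter> bd t = {}" using gp' nbeq by simp
  show "nb Vg D \<subseteq> region t" using nbb nbeq by (auto simp: nb_def zone_def)
  have "part t \<noteq> {}" using gp' t by (auto simp: node_ok_def)
  moreover have "connd (zone t)" using t connd_Vg connd_with_nb by (cases t) (auto simp: node_ok_def zone_simps)
  ultimately have "nb Vg D \<noteq> {}" unfolding nbeq using nb_ne[OF _ gp'(2) _ D] by blast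
  then show "node_ok (D # t)" using gp' nbeq comps_ne[OF D] comps_connd[OF D] DH hV
    by (auto simp: node_ok_def)
qed

lemma node_ok: "t \<in> nodes \<Longrightarrow> node_ok t"
proof (induction rule: nodes.induct)
  case root then show ?case using connd_Vg z0 by (auto simp: node_ok_def)
next
  case (child t D) then show ?case by (intro node_ok_child(6))
qed

lemma node_Cons: "D # t \<in> nodes \<longleftrightarrow> t \<in> nodes \<and> D \<in> comps (zone t - part t)"
  by (auto intro: nodes.child elim: nodes.cases)

lemma node_append: "u @ t \<in> nodes \<Longrightarrow> t \<in> nodes"
  by (induction u) (auto simp: node_Cons)


lemma child_props:
  assumes "D # t \<in> nodes"
  shows "D \<subseteq> region t" "D \<inter> part t = {}" "nb Vg D \<subseteq> part t" "nb Vg D \<subseteq> region t"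
    "nb Vg D \<inter> bd t = {}" "D \<subseteq> Vg" "connd D" "D \<noteq> {}" "finite (nb Vg D)"
    "nb Vg D \<subseteq> part (D # t)" "part (D # t) \<subseteq> D \<union> nb Vg D"
proof -
  have t: "node_ok t" and D: "D \<in> comps (zone t - part t)" using assms node_ok by (auto simp: node_Cons)
  show "D \<subseteq> region t" "D \<inter> part t = {}" "nb Vg D \<subseteq> part t" "nb Vg D \<subseteq> region t" "nb Vg D \<inter> bd t = {}"
    using node_ok_child[OF t D] by auto
  have "node_ok (D # t)" by (rule node_ok[OF assms])
  then show "D \<subseteq> Vg" "connd D" "D \<noteq> {}" "finite (nb Vg D)" by (auto simp: node_ok_def)
  show "nb Vg D \<subseteq> part (D # t)" "part (D # t) \<subseteq> D \<union> nb Vg D"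
    using node_ok_good_part[OF \<open>node_ok (D # t)\<close>] by (auto simp: good_part_def zone_simps)
qed

lemma part_props:
  assumes "t \<in> nodes"
  shows "bd t \<subseteq> part t" "part t \<subseteq> zone t" "connd (part t)" "part t \<noteq> {}" "part t \<subseteq> Vg"
    "region t \<subseteq> Vg" "connd (region t)" "region t \<noteq> {}"
proof -
  note ok = node_ok[OF assms]
  show gp: "bd t \<subseteq> part t" "part t \<subseteq> zone t" "connd (part t)"
    using node_ok_good_part[OF ok] by (auto simp: good_part_def)
  show "part t \<noteq> {}" using gp ok by (auto simp: node_ok_def)
  show "part t \<subseteq> Vg" using gp ok bd_sub by (fastforce simp: node_ok_def zone_def)
  show "region t \<subseteq> Vg" "connd (region t)" "region t \<noteq> {}" using ok by (auto simp: node_ok_def)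
qed

lemma separator_part:
  assumes "D # t \<in> nodes" shows "part (D # t) \<inter> part t = nb Vg D"
  using child_props[OF assms] by blast

section \<open>Nesting and disjointness of regions\<close>

lemma region_mono: "u @ t \<in> nodes \<Longrightarrow> region (u @ t) \<subseteq> region t"
proof (induction u)
  case (Cons D u)
  then show ?case using child_props(1)[of D "u @ t"] by (auto simp: node_Cons)
qed simp

lemma zone_mono: "u @ t \<in> nodes \<Longrightarrow> zone (u @ t) \<subseteq> zone t"
proof (induction u)
  case (Cons D u)
  then have "D \<union> nb Vg D \<subseteq> region (u @ t)" using child_props[of D "u @ t"] by simp
  moreover have "region (u @ t) \<subseteq> region t" using Cons.prems by (intro region_mono) (auto simp: node_Cons)
  ultimately show ?case by (simp add: zone_simps) (auto simp: zone_def)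
qed simp

text \<open>\<open>nb Vg D\<close> lies in the part of the common parent \<open>c\<close>, which the
  sibling region \<open>D'\<close> avoids.\<close>

lemma siblings_disjoint:
  assumes "u @ D # c \<in> nodes" "u' @ D' # c \<in> nodes" "D \<noteq> D'"
  shows "zone (u @ D # c) \<inter> region (u' @ D' # c) = {}"
proof -
  have n: "D # c \<in> nodes" "D' # c \<in> nodes" using assms node_append by blast+
  then have "D \<inter> D' = {}" using comps_disj assms(3) by (auto simp: node_Cons)
  moreover have "nb Vg D \<inter> D' = {}" using child_props(3)[OF n(1)] child_props(2)[OF n(2)] by blast
  moreover have "region (u' @ D' # c) \<subseteq> D'" using region_mono[OF assms(2)] by simp
  moreover have "zone (u @ D # c) \<subseteq> D \<union> nb Vg D" using zone_mono[OF assms(1)] by (simp add: zone_simps)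
  ultimately show ?thesis by blast
qed

lemma part_desc:
  assumes "s \<in> nodes" "suffix (D # c) s"
  shows "part s \<subseteq> D \<union> nb Vg D"
proof -
  obtain u where u: "s = u @ D # c" using assms by (auto simp: suffix_def)
  then have "zone s \<subseteq> zone (D # c)" using assms zone_mono by blast
  then show ?thesis using part_props(2)[OF assms(1)] by (simp add: zone_simps)
qed

text \<open>If \<open>s\<close> is strictly below \<open>t\<close>, the region of \<open>t\<close>
  lies in that of a child of \<open>s\<close>, which avoids \<open>part s\<close>; if the two are
  incomparable, their branches separate at siblings.\<close>

lemma part_nondesc:
  assumes s: "s \<in> nodes" and t: "t \<in> nodes" and ns: "\<not> suffix t s"
  shows "part s \<inter> region t = {}"
proof -
  consider "suffix s t" | "\<exists>u a c u' a'. s = u @ a # c \<and> t = u' @ a' # c \<and> a \<noteq> a'"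
    using suffix_trichotomy[of s t] ns by blast
  then show ?thesis
  proof cases
    case 1
    then obtain v where v: "t = v @ s" by (auto simp: suffix_def)
    then obtain v' D where "v = v' @ [D]" using ns by (cases v rule: rev_cases) auto
    then have t': "t = v' @ D # s" using v by simp
    then have "region t \<subseteq> D" using region_mono[of v' "D # s"] t by simp
    moreover have "D # s \<in> nodes" using t t' node_append by blast
    ultimately show ?thesis using child_props(2) by blast
  next
    case 2
    then obtain u a c u' a' where "s = u @ a # c" "t = u' @ a' # c" "a \<noteq> a'" by blast
    then show ?thesis using siblings_disjoint[of u a c u' a'] s t part_props(2)[OF s] by blast
  qed
qed

text \<open>The induction is on the length of a walk from \<open>u\<close> to the boundary of the
  current node, which shortens when passing to a child. Allowing \<open>u = v\<close> treats
  vertices and edges at once.\<close>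

lemma parts_cover_zone:
  assumes "t \<in> nodes" "u \<in> zone t" "v \<in> zone t" "u = v \<or> E u v" "(E ^^ n) u b" "b \<in> bd t"
  shows "\<exists>w. w @ t \<in> nodes \<and> u \<in> part (w @ t) \<and> v \<in> part (w @ t)"
  using assms
proof (induction n arbitrary: t b rule: less_induct)
  case (less n)
  have bdt: "bd t \<subseteq> part t" by (rule part_props[OF less.prems(1)])
  show ?case
  proof (cases "u \<in> part t")
    case True
    show ?thesis
    proof (cases "v \<in> part t")
      case True then show ?thesis using less.prems \<open>u \<in> part t\<close> by (intro exI[of _ "[]"]) auto
    next
      case False
      then obtain D where D: "D \<in> comps (zone t - part t)" "v \<in> D" using comp_of[of v "zone t - part t"] less.prems by blast
      then have Dt: "D # t \<in> nodes" using less.prems by (simp add: node_Cons)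
      note c = child_props[OF Dt]
      have "E v u" using False True less.prems E_sym by auto
      then have unb: "u \<in> nb Vg D" using D True c E_in by (auto simp: nb_def)
      \<comment> \<open>Otherwise \<open>v\<close> would lie in a grandchild region
        \<open>D2\<close>, and \<open>u\<close> would lie both in its neighbourhood and in the
        boundary of \<open>D # t\<close>, which are disjoint.\<close>
      have "v \<in> part (D # t)"
      proof (rule ccontr)
        assume "v \<notin> part (D # t)"
        then obtain D2 where D2: "D2 \<in> comps (zone (D # t) - part (D # t))" "v \<in> D2"
          using comp_of[of v "zone (D # t) - part (D # t)"] D by (auto simp: zone_simps)
        then have n2: "D2 # D # t \<in> nodes" using Dt by (simp add: node_Cons)
        have "u \<notin> D2" using child_props(2)[OF n2] unb c by blast
        then have "u \<in> nb Vg D2" using \<open>E v u\<close> D2 E_in by (auto simp: nb_def)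
        then show False using child_props(5)[OF n2] unb by auto
      qed
      then show ?thesis using Dt unb c by (intro exI[of _ "[D]"]) auto
    qed
  next
    case False
    then obtain D where D: "D \<in> comps (zone t - part t)" "u \<in> D" using comp_of[of u "zone t - part t"] less.prems by blast
    then have Dt: "D # t \<in> nodes" using less.prems by (simp add: node_Cons)
    note c = child_props[OF Dt]
    have "b \<notin> D" using bdt c less.prems by blast
    then obtain i x y where i: "(E ^^ i) u y" "x \<in> D" "y \<notin> D" "E x y" "i < n \<or> i = n \<and> y = b"
      using relpowp_exit[OF less.prems(5) D(2)] by blast
    have y: "y \<in> nb Vg D" using i E_in by (auto simp: nb_def)
    then have "y \<noteq> b" using c less.prems by blast
    then have "i < n" using i by blast
    moreover have "v \<in> zone (D # t)" using D less.prems E_in by (auto simp: zone_simps nb_def)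
    moreover have "u \<in> zone (D # t)" using D by (simp add: zone_simps)
    ultimately obtain w where "w @ D # t \<in> nodes" "u \<in> part (w @ D # t)" "v \<in> part (w @ D # t)"
      using less.IH[of i "D # t" y] Dt less.prems i y by auto
    then show ?thesis by (intro exI[of _ "w @ [D]"]) auto
  qed
qed

lemma parts_cover:
  assumes "t \<in> nodes" "u \<in> zone t" "v \<in> zone t" "u = v \<or> E u v"
  shows "\<exists>w. w @ t \<in> nodes \<and> u \<in> part (w @ t) \<and> v \<in> part (w @ t)"
proof -
  have ok: "node_ok t" by (rule node_ok[OF assms(1)])
  obtain b where b: "b \<in> bd t" using ok by (auto simp: node_ok_def)
  have "u \<in> Vg" using assms(2) ok bd_sub by (auto simp: zone_def node_ok_def)
  then have "conn Vg u b" using conndD[OF connd_Vg] b bd_sub by blast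
  then have "(\<lambda>x y. E x y \<and> x \<in> Vg \<and> y \<in> Vg)\<^sup>*\<^sup>* u b" by (simp add: conn_def)
  then have "E\<^sup>*\<^sup>* u b" by (rule rtranclp_mono[THEN predicate2D, rotated]) auto
  then obtain n where "(E ^^ n) u b" by (auto simp: rtranclp_power)
  then show ?thesis using parts_cover_zone assms b by blast
qed

lemma region_covered: "t \<in> nodes \<Longrightarrow> v \<in> region t \<Longrightarrow> \<exists>w. w @ t \<in> nodes \<and> v \<in> part (w @ t)"
  using parts_cover[of t v v] by (auto simp: zone_def)

lemma region_in_side:
  assumes "s \<in> nodes" "D # c \<in> nodes" "suffix (D # c) s"
  shows "region s \<subseteq> (\<Union>t\<in>{t \<in> nodes. suffix (D # c) t}. part t) - nb Vg D"
proof
  fix v assume v: "v \<in> region s"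
  obtain u where u: "s = u @ D # c" using assms by (auto simp: suffix_def)
  have "v \<in> D" using v region_mono[of u "D # c"] u assms by auto
  then have "v \<notin> nb Vg D" by (auto simp: nb_def)
  moreover obtain w where "w @ s \<in> nodes" "v \<in> part (w @ s)" using region_covered[OF assms(1) v] by blast
  moreover have "suffix (D # c) (w @ s)" using u by (auto simp: suffix_def)
  ultimately show "v \<in> (\<Union>t\<in>{t \<in> nodes. suffix (D # c) t}. part t) - nb Vg D" by blast
qed

text \<open>Incomparability of \<open>s\<close> and \<open>D # c\<close> is what keeps the separator
  \<open>nb Vg D\<close> out of the region of \<open>s\<close>; the region of a node below
  \<open>D # c\<close> contains \<open>D\<close>.\<close>

lemma region_out_side:
  assumes "s \<in> nodes" "D # c \<in> nodes" "\<not> suffix (D # c) s" "\<not> suffix s (D # c)"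
  shows "region s \<subseteq> (\<Union>t\<in>{t \<in> nodes. \<not> suffix (D # c) t}. part t) - nb Vg D"
proof
  fix v assume v: "v \<in> region s"
  obtain u a e u' a' where d: "s = u @ a # e" "D # c = u' @ a' # e" "a \<noteq> a'"
    using suffix_trichotomy[of s "D # c"] assms by blast
  have "zone (u' @ a' # e) \<inter> region (u @ a # e) = {}"
    by (rule siblings_disjoint) (use assms d in auto)
  then have "zone (D # c) \<inter> region s = {}" unfolding d(1,2) .
  then have "v \<notin> nb Vg D" using v by (auto simp: zone_simps)
  moreover obtain w where w: "w @ s \<in> nodes" "v \<in> part (w @ s)" using region_covered[OF assms(1) v] by blast
  moreover have "\<not> suffix (D # c) (w @ s)"
    using assms(3,4) suffix_same_cases[of "D # c" "w @ s" s] by (auto simp: suffix_def)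
  ultimately show "v \<in> (\<Union>t\<in>{t \<in> nodes. \<not> suffix (D # c) t}. part t) - nb Vg D" by blast
qed

text \<open>A branch may start at any node, so that tails of rays of the tree qualify.\<close>

definition branch :: "(nat \<Rightarrow> 'a set list) \<Rightarrow> bool" where
  "branch \<sigma> \<longleftrightarrow> (\<forall>i. \<sigma> i \<in> nodes \<and> (\<exists>D. \<sigma> (Suc i) = D # \<sigma> i))"

lemma branchD:
  assumes "branch \<sigma>"
  shows "\<sigma> i \<in> nodes" "\<sigma> (Suc i) = region (\<sigma> (Suc i)) # \<sigma> i" "bd (\<sigma> (Suc i)) = nb Vg (region (\<sigma> (Suc i)))"
    "length (\<sigma> i) = length (\<sigma> 0) + i"
proof -
  have *: "\<exists>D. \<sigma> (Suc i) = D # \<sigma> i" for i using assms by (auto simp: branch_def)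
  show "\<sigma> i \<in> nodes" using assms by (auto simp: branch_def)
  show "\<sigma> (Suc i) = region (\<sigma> (Suc i)) # \<sigma> i" "bd (\<sigma> (Suc i)) = nb Vg (region (\<sigma> (Suc i)))"
    using *[of i] by auto
  show "length (\<sigma> i) = length (\<sigma> 0) + i"
  proof (induction i)
    case (Suc i) then show ?case using *[of i] by auto
  qed simp
qed

lemma branch_dec:
  assumes "branch \<sigma>"
  shows "region (\<sigma> (Suc i)) \<subseteq> region (\<sigma> i)" "nb Vg (region (\<sigma> (Suc i))) \<subseteq> region (\<sigma> i)"
  using child_props[of "region (\<sigma> (Suc i))" "\<sigma> i"] branchD(1,2)[OF assms] by metis+

lemma branch_anti:
  assumes "branch \<sigma>" "i \<le> j" shows "region (\<sigma> j) \<subseteq> region (\<sigma> i)"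
  using assms(2) by (induction rule: dec_induct) (use branch_dec(1)[OF assms(1)] in auto)

text \<open>A vertex \<open>v\<close> lies in the part of some node \<open>t\<close>. A node of the
  branch longer than \<open>t\<close> is not an ancestor of \<open>t\<close>, so its region avoids
  \<open>part t\<close>.\<close>

lemma branch_empty:
  assumes "branch \<sigma>" shows "\<exists>i. v \<notin> region (\<sigma> i)"
proof (cases "v \<in> Vg")
  case True
  then obtain t where t: "t \<in> nodes" "v \<in> part t" using parts_cover[OF nodes.root, of v v] by (auto simp: zone_simps)
  have "\<not> suffix (\<sigma> (Suc (length t))) t"
    using branchD(4)[OF assms, of "Suc (length t)"] suffix_length_le by fastforce
  then have "v \<notin> region (\<sigma> (Suc (length t)))" using part_nondesc[OF t(1) branchD(1)[OF assms]] t(2) by blast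
  then show ?thesis by blast
next
  case False
  then show ?thesis using part_props(6)[OF branchD(1)[OF assms]] by blast
qed

lemma branch_avoids_finite:
  assumes "branch \<sigma>" "finite S" shows "\<exists>i. S \<inter> region (\<sigma> i) = {}"
  using assms(2)
proof (induction rule: finite_induct)
  case (insert v S)
  then obtain i where i: "S \<inter> region (\<sigma> i) = {}" by blast
  obtain j where j: "v \<notin> region (\<sigma> j)" using branch_empty[OF assms(1)] by blast
  have "insert v S \<inter> region (\<sigma> (max i j)) = {}"
    using i j branch_anti[OF assms(1), of i "max i j"] branch_anti[OF assms(1), of j "max i j"] by auto
  then show ?case by blast
qed simp

lemma branch_ray:
  assumes "branch \<sigma>"
  shows "\<exists>r. rayin Vg r \<and> (\<forall>i. has_tail_in r (region (\<sigma> i)))"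
proof -
  have "\<exists>r. rayin (region (\<sigma> 0)) r \<and> (\<forall>i. has_tail_in r (region (\<sigma> i)))"
    by (rule ray_of_nested_connd)
      (use branch_dec[OF assms] part_props[OF branchD(1)[OF assms]] branch_empty[OF assms] in auto)
  then show ?thesis using part_props(6)[OF branchD(1)[OF assms]] unfolding rayin_def by blast
qed

text \<open>A finite \<open>S\<close> misses some region along the branch, and that region is
  connected and contains tails of both rays.\<close>

lemma branch_rays_equiv:
  assumes b: "branch \<sigma>" and r: "\<And>i. has_tail_in r (region (\<sigma> i))" and s: "\<And>i. has_tail_in s (region (\<sigma> i))"
  shows "tail_equiv Vg r s"
proof (rule tail_equivI)
  fix S :: "'a set" assume "finite S"
  then obtain i where i: "S \<inter> region (\<sigma> i) = {}" using branch_avoids_finite[OF b] by blast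
  obtain n where n: "\<forall>k\<ge>n. r k \<in> region (\<sigma> i)" using r by (auto simp: has_tail_in_def)
  obtain m where m: "\<forall>k\<ge>m. s k \<in> region (\<sigma> i)" using s by (auto simp: has_tail_in_def)
  note p = part_props(6,7)[OF branchD(1)[OF b], of i]
  have "conn (region (\<sigma> i)) (r n) (s m)" using conndD[OF p(2)] n m by simp
  then have "conn (Vg - S) (r n) (s m)" by (rule conn_mono) (use i p in blast)
  then show "\<exists>n m. (\<forall>i\<ge>n. r i \<notin> S) \<and> (\<forall>i\<ge>m. s i \<notin> S) \<and> conn (Vg - S) (r n) (s m)"
    using n m i by blast
qed

lemma tail_equiv_region:
  assumes "tail_equiv Vg r s" "rayin Vg r" "rayin Vg s" "t \<in> nodes" "has_tail_in r (region t)"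
  shows "has_tail_in s (region t)"
proof (cases t)
  case Nil then show ?thesis using rayinD(2)[OF assms(3)] by (auto simp: has_tail_in_def)
next
  case (Cons D c)
  then show ?thesis using tail_equiv_has_tail[OF assms(1-3), of D] child_props(9)[of D c] assms by simp
qed

text \<open>At every node whose region contains a tail of \<open>r\<close>, the last clause of
  \<open>good_part\<close> moves a tail on into a child region, so \<open>r\<close> never settles in
  a part.\<close>

lemma undominated_ray_branch:
  assumes r: "rayin Vg r" and und: "\<And>x. x \<in> Vg \<Longrightarrow> \<not> domin Vg x r"
  shows "\<exists>\<sigma>. branch \<sigma> \<and> \<sigma> 0 = [] \<and> (\<forall>i. has_tail_in r (region (\<sigma> i)))"
proof -
  have step: "\<exists>D. D # t \<in> nodes \<and> has_tail_in r D" if t: "t \<in> nodes" "has_tail_in r (region t)" for t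
  proof -
    obtain n where n: "\<forall>k\<ge>n. r k \<in> region t" using t(2) by (auto simp: has_tail_in_def)
    \<comment> \<open>The shifted ray lies entirely in the region, as \<open>rayin (zone t)\<close>
      requires. Domination of \<open>q\<close> in the zone would give domination of \<open>r\<close>
      in the whole graph.\<close>
    define q where "q k = r (k + n)" for k
    have hV: "zone t \<subseteq> Vg" using part_props(6)[OF t(1)] bd_sub by (auto simp: zone_def)
    have "inj q" using injD[OF rayinD(1)[OF r]] by (intro injI) (fastforce simp: q_def)
    then have q: "rayin (zone t) q" using n rayinD(3)[OF r] by (auto simp: rayin_def q_def zone_def)
    have "\<not> domin (zone t) x q" if "x \<in> bd t" for x
    proof
      assume dom: "domin (zone t) x q"
      have "tconn Vg S r x" if S: "finite S" "x \<notin> S" for S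
      proof -
        have "tconn Vg S q x" using dom S tconn_mono[OF _ hV order_refl] unfolding domin_def by blast
        then obtain k where k: "\<forall>m\<ge>k. r (m + n) \<notin> S" "conn (Vg - S) (r (k + n)) x"
          by (auto simp: tconn_def q_def)
        have "r m \<notin> S" if "m \<ge> k + n" for m using k(1)[rule_format, of "m - n"] that by simp
        then show ?thesis using k(2) unfolding tconn_def by blast
      qed
      then have "domin Vg x r" by (auto simp: domin_def)
      then show False using und that bd_sub by blast
    qed
    then obtain D m where D: "D \<in> comps (zone t - part t)" "\<forall>k\<ge>m. q k \<in> D"
      using node_ok_good_part[OF node_ok[OF t(1)]] q unfolding good_part_def by blast
    have "r k \<in> D" if "k \<ge> m + n" for k
      using D(2)[rule_format, of "k - n"] that by (simp add: q_def)
    with D(1) show ?thesis using t unfolding has_tail_in_def by (auto simp: node_Cons)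
  qed
  have "\<exists>\<sigma>. \<sigma> 0 = [] \<and> (\<forall>i. (\<sigma> i \<in> nodes \<and> has_tail_in r (region (\<sigma> i))) \<and> (\<exists>D. \<sigma> (Suc i) = D # \<sigma> i))"
  proof -
    define nx where "nx t = (SOME D. D # t \<in> nodes \<and> has_tail_in r D) # t" for t
    define \<sigma> where "\<sigma> i = (nx ^^ i) []" for i
    have s: "\<sigma> 0 = []" "\<sigma> (Suc i) = nx (\<sigma> i)" for i by (simp_all add: \<sigma>_def)
    have nx: "nx t \<in> nodes \<and> has_tail_in r (region (nx t))" if "t \<in> nodes" "has_tail_in r (region t)" for t
      using someI_ex[OF step[OF that]] by (simp add: nx_def)
    have "\<sigma> i \<in> nodes \<and> has_tail_in r (region (\<sigma> i))" for i
    proof (induction i)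
      case 0 then show ?case using nodes.root rayinD(2)[OF r] by (auto simp: s has_tail_in_def)
    next
      case (Suc i) then show ?case using nx by (simp add: s)
    qed
    moreover have "\<exists>D. \<sigma> (Suc i) = D # \<sigma> i" for i unfolding s nx_def by blast
    ultimately show ?thesis using s(1) by blast
  qed
  then show ?thesis unfolding branch_def by blast
qed

end

section \<open>The decomposition tree\<close>

context rooted_graph
begin

definition dtree :: "'a set list pair_pre_digraph" where
  "dtree = \<lparr>pverts = nodes,
     parcs = {(s, t). s \<in> nodes \<and> t \<in> nodes \<and> ((\<exists>D. s = D # t) \<or> (\<exists>D. t = D # s))}\<rparr>"

lemma dtree_simps [simp]:
  "pverts dtree = nodes"
  "(s, t) \<in> parcs dtree \<longleftrightarrow> s \<in> nodes \<and> t \<in> nodes \<and> ((\<exists>D. s = D # t) \<or> (\<exists>D. t = D # s))"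
  by (simp_all add: dtree_def)

lemma dtree_bidirected: "pair_bidirected_digraph dtree"
proof
  show "symmetric (with_proj dtree)" by (auto simp: symmetric_def sym_def)
qed auto

end

sublocale rooted_graph \<subseteq> T: bidirected_graph dtree
  by (rule bidirected_graph.intro[OF dtree_bidirected])

context rooted_graph
begin

text \<open>Lying above \<open>D # c\<close> changes only along the edge between \<open>c\<close>
  and \<open>D # c\<close>. This invariant serves for acyclicity, the sides of an edge, the path
  condition and the tree order.\<close>

lemma arc_status:
  assumes "(s, t) \<in> parcs dtree" "(s, t) \<noteq> (D # c, c)" "(s, t) \<noteq> (c, D # c)"
  shows "suffix (D # c) s \<longleftrightarrow> suffix (D # c) t"
  using assms by (auto simp: suffix_Cons)

lemma vwalk_status:
  assumes "set (vwalk_arcs p) \<subseteq> parcs dtree" "c \<notin> set p \<or> D # c \<notin> set p" "s \<in> set p" "t \<in> set p"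
  shows "suffix (D # c) s \<longleftrightarrow> suffix (D # c) t"
proof -
  have "\<forall>s\<in>set p. suffix (D # c) s \<longleftrightarrow> suffix (D # c) (hd p)"
    using assms(1,2)
  proof (induction p rule: vwalk_arcs.induct)
    case (3 x y xs)
    have "suffix (D # c) x \<longleftrightarrow> suffix (D # c) y" by (rule arc_status) (use 3 in auto)
    then show ?case using 3 by auto
  qed auto
  then show ?thesis using assms(3,4) by blast
qed

lemma connd_nodes: "T.connd nodes"
proof (rule T.connd_from)
  fix t assume "t \<in> nodes"
  then show "T.conn nodes [] t"
  proof (induction rule: nodes.induct)
    case root then show ?case by (intro T.conn_refl nodes.root)
  next
    case (child t D)
    then have "D # t \<in> nodes" by (simp add: nodes.child)
    then have "T.conn nodes t (D # t)" using child by (intro T.conn_step) auto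
    then show ?case using child T.conn_trans by blast
  qed
qed

lemma tree_side_status:
  assumes "t \<in> tree_side dtree x y" "{x, y} = {D # c, c}"
  shows "t \<in> nodes \<and> (suffix (D # c) t \<longleftrightarrow> suffix (D # c) x)"
proof -
  let ?A = "parcs dtree - {(x, y), (y, x)}"
  have "(x, t) \<in> rtrancl_on nodes ?A"
    using assms(1) by (simp add: tree_side_def reachable_def)
  then show ?thesis
  proof (induction rule: rtrancl_on_induct)
    case base then show ?case by simp
  next
    case (step s t)
    have "suffix (D # c) s \<longleftrightarrow> suffix (D # c) t"
      by (rule arc_status) (use step(2) assms(2) in \<open>auto simp: doubleton_eq_iff\<close>)
    then show ?case using step by blast
  qed
qed

lemma tree_side_up:
  assumes n: "D # c \<in> nodes"
  shows "tree_side dtree (D # c) c = {t \<in> nodes. suffix (D # c) t}"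
proof (intro set_eqI iffI)
  fix t assume "t \<in> tree_side dtree (D # c) c"
  then show "t \<in> {t \<in> nodes. suffix (D # c) t}" using tree_side_status[of t "D # c" c D c] by simp
next
  fix t assume "t \<in> {t \<in> nodes. suffix (D # c) t}"
  then obtain u where u: "t = u @ D # c" "t \<in> nodes" by (auto simp: suffix_def)
  have "(D # c, u @ D # c) \<in> rtrancl_on nodes (parcs dtree - {(D # c, c), (c, D # c)})"
    using u(2) unfolding u(1)
  proof (induction u)
    case Nil then show ?case by simp
  next
    case (Cons a u)
    then have "u @ D # c \<in> nodes" by (simp add: node_Cons)
    moreover have "u @ D # c \<noteq> c" "a # u @ D # c \<noteq> c"
      by (metis append_Cons append_assoc append_self_conv2 list.distinct(1) append.left_neutral self_append_conv2 Cons_eq_appendI)+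
    ultimately show ?case using Cons by (intro rtrancl_on_into_rtrancl_on[OF Cons.IH]) auto
  qed
  then show "t \<in> tree_side dtree (D # c) c" using u by (simp add: tree_side_def reachable_def)
qed

lemma tree_side_down:
  assumes n: "D # c \<in> nodes"
  shows "tree_side dtree c (D # c) = {t \<in> nodes. \<not> suffix (D # c) t}"
proof (intro set_eqI iffI)
  fix t assume "t \<in> tree_side dtree c (D # c)"
  then show "t \<in> {t \<in> nodes. \<not> suffix (D # c) t}"
    using tree_side_status[of t c "D # c" D c] suffix_length_le[of "D # c" c] by auto
next
  let ?A = "parcs dtree - {(c, D # c), (D # c, c)}"
  \<comment> \<open>Both sides of the argument go through the root: the chain of suffixes of
    \<open>t\<close> uses the deleted edge only if \<open>D # c\<close> is one of them.\<close>
  have to_root: "([], t) \<in> rtrancl_on nodes ?A \<and> (t, []) \<in> rtrancl_on nodes ?A"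
    if "t \<in> nodes" "\<not> suffix (D # c) t" for t
    using that
  proof (induction t rule: list.induct)
    case Nil then show ?case by simp
  next
    case (Cons a t)
    have t: "t \<in> nodes" "\<not> suffix (D # c) t" using Cons.prems by (auto simp: node_Cons suffix_Cons)
    then have IH: "([], t) \<in> rtrancl_on nodes ?A" "(t, []) \<in> rtrancl_on nodes ?A" using Cons.IH by auto
    have "(t, a # t) \<in> ?A" "(a # t, t) \<in> ?A" using Cons.prems t by (auto simp: suffix_Cons)
    then show ?case using rtrancl_on_into_rtrancl_on[OF IH(1)] converse_rtrancl_on_into_rtrancl_on[OF _ IH(2)]
        Cons.prems(1) by blast
  qed
  fix t assume t: "t \<in> {t \<in> nodes. \<not> suffix (D # c) t}"
  have "c \<in> nodes" using n by (simp add: node_Cons)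
  moreover have "\<not> suffix (D # c) c" using suffix_length_le[of "D # c" c] by auto
  ultimately have "(c, t) \<in> rtrancl_on nodes ?A"
    using rtrancl_on_trans[of c "[]" nodes ?A t] to_root[of c] to_root[of t] t by simp
  then show "t \<in> tree_side dtree c (D # c)" by (simp add: tree_side_def reachable_def)
qed

lemma arc_cases:
  assumes "(x, y) \<in> parcs dtree"
  obtains D c where "D # c \<in> nodes" "x = D # c" "y = c" | D c where "D # c \<in> nodes" "x = c" "y = D # c"
  using assms by auto

lemma arc_doubleton: "(x, y) \<in> parcs dtree \<Longrightarrow> \<exists>D c. D # c \<in> nodes \<and> {x, y} = {D # c, c}"
  by (elim arc_cases) blast+

lemma vwalk_arcs_split:
  assumes "set (vwalk_arcs (p @ q)) \<subseteq> A"
  shows "set (vwalk_arcs p) \<subseteq> A" "set (vwalk_arcs q) \<subseteq> A"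
  using assms vwalk_arcs_append[of p q] by (cases "p = []"; cases "q = []"; auto)+

lemma dtree_tree: "undirected_tree dtree"
proof -
  have "\<not> (pre_digraph.cycle (with_proj dtree) p \<and> length p \<ge> 3)" for p
  proof
    assume p: "pre_digraph.cycle (with_proj dtree) p \<and> length p \<ge> 3"
    then obtain u where u: "pre_digraph.awalk (with_proj dtree) u p u" "distinct (tl (pawalk_verts u p))"
      by (auto simp: pre_digraph.cycle_def awalk_verts_with_proj_eq)
    have cas: "pcas u p u" "set p \<subseteq> parcs dtree" using u(1) by (auto simp: pre_digraph.awalk_def cas_with_proj_eq)
    have arcs: "vwalk_arcs (pawalk_verts a q) = q" if "pcas a q b" for a b :: "'a set list" and q
      using that
    proof (induction a q b rule: pcas.induct)
      case (2 a e es b) then show ?case by (cases es) auto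
    qed simp
    have len: "length (pawalk_verts a q) = Suc (length q)" for a :: "'a set list" and q
      by (induction q arbitrary: a) auto
    then have ne: "pawalk_verts a q \<noteq> []" for a :: "'a set list" and q
      by (metis list.size(3) nat.distinct(1))
    have lst: "last (pawalk_verts a q) = b" if "pcas a q b" for a b :: "'a set list" and q
      using that by (induction a q b rule: pcas.induct) (auto simp: ne)
    define w where "w = pawalk_verts u p"
    have w: "vwalk_arcs w = p" "last w = u" "length w \<ge> 4" "distinct (tl w)"
      using arcs[OF cas(1)] lst[OF cas(1)] len[of u p] p u(2) by (auto simp: w_def)
    have "hd w = u" unfolding w_def using cas p by (cases p) auto
    then obtain y q where xy: "w = u # y # q" using w(3) by (cases w; cases "tl w") auto
    then have "q \<noteq> []" using w(3) by auto
    then obtain m where q: "q = m @ [u]" using w(2) xy append_butlast_last_id[of q] by (metis last_ConsR list.distinct(1))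
    \<comment> \<open>The bound 3 on the length of the cycle enters here: an edge traversed back and
      forth would leave \<open>m\<close> empty.\<close>
    have m: "m \<noteq> []" using w(3) xy q by auto
    have sub: "set (vwalk_arcs w) \<subseteq> parcs dtree" using w(1) cas(2) by simp
    have wq: "w = [u] @ (y # m) @ [u]" using xy q by simp
    have a: "(u, y) \<in> parcs dtree" using sub xy by auto
    have a1: "set (vwalk_arcs (y # m)) \<subseteq> parcs dtree"
      using sub vwalk_arcs_split(1)[OF vwalk_arcs_split(2)] unfolding wq by blast
    have a2: "set (vwalk_arcs (m @ [u])) \<subseteq> parcs dtree"
      using sub vwalk_arcs_split(2)[of "[u, y]" "m @ [u]"] unfolding wq by simp
    have d: "u \<notin> set (y # m)" "y \<notin> set (m @ [u])" using w(4) by (auto simp: wq)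
    obtain D c where Dc: "{u, y} = {D # c, c}" using arc_doubleton[OF a] by blast
    \<comment> \<open>The cycle without its first edge would join the two sides of that edge.\<close>
    have "suffix (D # c) y \<longleftrightarrow> suffix (D # c) (last m)"
      by (rule vwalk_status[OF a1]) (use d Dc m in \<open>auto simp: doubleton_eq_iff\<close>)
    moreover have "suffix (D # c) (last m) \<longleftrightarrow> suffix (D # c) u"
      by (rule vwalk_status[OF a2]) (use d Dc m in \<open>auto simp: doubleton_eq_iff\<close>)
    moreover have "\<not> suffix (D # c) c" using suffix_length_le[of "D # c" c] by auto
    ultimately show False using Dc by (auto simp: doubleton_eq_iff)
  qed
  moreover have "connected (with_proj dtree)" using connd_nodes nodes.root by (auto simp: T.connected_iff)
  ultimately show ?thesis using dtree_bidirected by (auto simp: undirected_tree_def)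
qed

text \<open>The edge of the path that leaves \<open>t2\<close> towards \<open>t3\<close> separates
  \<open>t1\<close> from \<open>t3\<close> in the tree. A vertex of both end parts therefore lies in
  the separator of this edge, hence in \<open>part t2\<close>.\<close>

lemma on_path_part:
  assumes "on_path dtree t1 t2 t3"
  shows "part t1 \<inter> part t3 \<subseteq> part t2"
proof
  fix v assume v: "v \<in> part t1 \<inter> part t3"
  obtain p where p: "vpath p (with_proj dtree)" "hd p = t1" "last p = t3" "t2 \<in> set p"
    using assms by (auto simp: on_path_def)
  then have w: "set (vwalk_arcs p) \<subseteq> parcs dtree" "distinct p" "set p \<subseteq> nodes" by (auto simp: vpath_def vwalk_def)
  obtain p1 p3 where s: "p = p1 @ t2 # p3" using split_list[OF p(4)] by blast
  show "v \<in> part t2"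
  proof (cases p3)
    case Nil then show ?thesis using s p v by auto
  next
    case (Cons t q)
    have s1: "p = (p1 @ [t2]) @ (t # q)" using s Cons by simp
    have w1: "set (vwalk_arcs (p1 @ [t2])) \<subseteq> parcs dtree" "set (vwalk_arcs (t # q)) \<subseteq> parcs dtree"
      using vwalk_arcs_split w(1) unfolding s1 by blast+
    have "(t2, t) \<in> parcs dtree"
      using vwalk_arcs_split(2)[of p1 "t2 # t # q" "parcs dtree"] w(1) unfolding s1 by simp
    then obtain D c where Dc: "D # c \<in> nodes" "{t2, t} = {D # c, c}" using arc_doubleton by blast
    have t1: "t1 \<in> set (p1 @ [t2])" using p(2) s by (cases p1) auto
    have t3: "t3 \<in> set (t # q)" using p(3) s1 by (metis last_append last_in_set list.distinct(1))
    have e1: "suffix (D # c) t1 \<longleftrightarrow> suffix (D # c) t2"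
      by (rule vwalk_status[OF w1(1)]) (use t1 w(2) s1 Dc in \<open>auto simp: doubleton_eq_iff\<close>)
    have e2: "suffix (D # c) t3 \<longleftrightarrow> suffix (D # c) t"
      by (rule vwalk_status[OF w1(2)]) (use t3 w(2) s1 Dc in \<open>auto simp: doubleton_eq_iff\<close>)
    have "\<not> suffix (D # c) c" using suffix_length_le[of "D # c" c] by auto
    then have ne: "suffix (D # c) t1 \<noteq> suffix (D # c) t3" using e1 e2 Dc by (auto simp: doubleton_eq_iff)
    have tn: "t1 \<in> nodes" "t3 \<in> nodes" using t1 t3 w(3) s1 by auto
    have "v \<in> D \<union> nb Vg D" "v \<notin> D"
      using ne v part_desc[OF tn(1), of D c] part_desc[OF tn(2), of D c]
        part_nondesc[OF tn(1) Dc(1)] part_nondesc[OF tn(2) Dc(1)] by auto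
    then have "v \<in> part (D # c) \<inter> part c" using separator_part[OF Dc(1)] by blast
    then show ?thesis using Dc(2) by (auto simp: doubleton_eq_iff)
  qed
qed

text \<open>A path from the root can enter the nodes above \<open>s = D # c\<close> only through
  \<open>c\<close>. After \<open>s\<close> it does not visit \<open>c\<close> again, so it stays
  above \<open>s\<close>.\<close>

lemma tree_le_suffix:
  assumes "tree_le dtree [] s t" shows "suffix s t"
proof (rule ccontr)
  assume ns: "\<not> suffix s t"
  obtain p where p: "vpath p (with_proj dtree)" "hd p = []" "last p = t" "s \<in> set p"
    using assms by (auto simp: tree_le_def on_path_def)
  then have w: "set (vwalk_arcs p) \<subseteq> parcs dtree" "distinct p" by (auto simp: vpath_def vwalk_def)
  obtain D c where s: "s = D # c" using ns by (cases s) auto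
  obtain p1 p3 where sp: "p = p1 @ s # p3" using split_list[OF p(4)] by blast
  have w1: "set (vwalk_arcs (p1 @ [s])) \<subseteq> parcs dtree" "set (vwalk_arcs (s # p3)) \<subseteq> parcs dtree"
    using vwalk_arcs_split[of "p1 @ [s]" p3] vwalk_arcs_split[of p1 "s # p3"] w(1) unfolding sp by simp_all
  have "[] \<in> set (p1 @ [s])" using p(2) sp by (cases p1) auto
  then have "c \<in> set (p1 @ [s])"
    using vwalk_status[OF w1(1), of c D "[]" s] unfolding s by auto
  then have "c \<in> set p1" using s by auto
  then have c: "c \<notin> set (s # p3)" using w(2) sp by auto
  have "t \<in> set (s # p3)" using p(3) sp by auto
  then show False using vwalk_status[OF w1(2), of c D s t] c ns unfolding s by auto
qed

lemma dtree_decomposition: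
  "\<forall>t\<in>nodes. part t \<subseteq> Vg" "\<forall>v\<in>Vg. \<exists>t\<in>nodes. v \<in> part t" "E u v \<Longrightarrow> \<exists>t\<in>nodes. u \<in> part t \<and> v \<in> part t"
proof -
  show "\<forall>t\<in>nodes. part t \<subseteq> Vg" using part_props(5) by blast
  show "\<forall>v\<in>Vg. \<exists>t\<in>nodes. v \<in> part t"
    using parts_cover[OF nodes.root] by (fastforce simp: zone_simps)
  show "\<exists>t\<in>nodes. u \<in> part t \<and> v \<in> part t" if "E u v"
    using parts_cover[OF nodes.root, of u v] E_in[OF that] that by (auto simp: zone_simps)
qed

lemma separator_eq: "D # c \<in> nodes \<Longrightarrow> separator part (D # c) c = nb Vg D"
  "D # c \<in> nodes \<Longrightarrow> separator part c (D # c) = nb Vg D"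
  using separator_part[of D c] by (auto simp: separator_def)

lemma dtree_finite_adhesion: "finite_adhesion dtree part"
  unfolding finite_adhesion_def
proof (intro allI impI)
  fix x y assume "x \<rightarrow>\<^bsub>with_proj dtree\<^esub> y"
  then have "(x, y) \<in> parcs dtree" by simp
  then show "finite (separator part x y)"
    by (cases rule: arc_cases) (auto simp: separator_eq child_props(9))
qed

lemma upward_arcD:
  assumes "upward_arc dtree [] x y"
  shows "\<exists>D. y = D # x \<and> D # x \<in> nodes"
proof -
  have "(x, y) \<in> parcs dtree" "suffix x y" using assms tree_le_suffix by (auto simp: upward_arc_def)
  then show ?thesis using suffix_length_le[of x y] by auto
qed

text \<open>The upper separator lies in the region of \<open>x'\<close> and hence in
  \<open>D\<close>, whereas the lower one is the neighbourhood of \<open>D\<close>.\<close>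

lemma dtree_upwards_disjoint: "upwards_disjoint_separators dtree [] part"
  unfolding upwards_disjoint_separators_def
proof (intro allI impI)
  fix x y x' y' assume a: "upward_arc dtree [] x y \<and> upward_arc dtree [] x' y' \<and> tree_le dtree [] y x'"
  obtain D where D: "y = D # x" "D # x \<in> nodes" using a upward_arcD by blast
  obtain D' where D': "y' = D' # x'" "D' # x' \<in> nodes" using a upward_arcD by blast
  obtain u where u: "x' = u @ D # x" using a tree_le_suffix D by (auto simp: suffix_def)
  have "nb Vg D' \<subseteq> region x'" using child_props(4)[OF D'(2)] .
  also have "\<dots> \<subseteq> D" using region_mono[of u "D # x"] D' u by (auto simp: node_Cons)
  finally show "separator part x y \<inter> separator part x' y' = {}"
    using D D' by (auto simp: separator_eq nb_def)
qed

text \<open>Lengths cannot decrease forever, so some step leads to a child. Parents are unique, so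
  by injectivity all later steps lead to children too.\<close>

lemma ray_eventually_branch:
  assumes \<rho>: "T.rayin nodes \<rho>"
  shows "\<exists>N. branch (\<lambda>i. \<rho> (i + N))"
proof -
  have arc: "(\<rho> n, \<rho> (Suc n)) \<in> parcs dtree" for n using T.rayinD(3)[OF \<rho>] .
  have inj: "inj \<rho>" using T.rayinD(1)[OF \<rho>] .
  have "\<exists>N. \<exists>D. \<rho> (Suc N) = D # \<rho> N"
  proof (rule ccontr)
    assume no: "\<nexists>N. \<exists>D. \<rho> (Suc N) = D # \<rho> N"
    then have "\<exists>D. \<rho> n = D # \<rho> (Suc n)" for n using arc[of n] by auto
    then have l: "length (\<rho> n) = Suc (length (\<rho> (Suc n)))" for n by (metis length_Cons)
    have "length (\<rho> n) + n = length (\<rho> 0)" for n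
    proof (induction n)
      case (Suc n) then show ?case using l[of n] by simp
    qed simp
    from this[of "Suc (length (\<rho> 0))"] show False by simp
  qed
  then obtain N where N: "\<exists>D. \<rho> (Suc N) = D # \<rho> N" by blast
  have "\<exists>D. \<rho> (Suc (i + N)) = D # \<rho> (i + N)" for i
  proof (induction i)
    case 0 then show ?case using N by simp
  next
    case (Suc i)
    then obtain D where D: "\<rho> (Suc (i + N)) = D # \<rho> (i + N)" by blast
    have "\<rho> (Suc (Suc (i + N))) \<noteq> \<rho> (i + N)" using injD[OF inj, of "Suc (Suc (i + N))" "i + N"] by auto
    then show ?case using arc[of "Suc (i + N)"] D by auto
  qed
  then have "branch (\<lambda>i. \<rho> (i + N))" using T.rayinD(2)[OF \<rho>] by (auto simp: branch_def)
  then show ?thesis ..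
qed

lemma branch_is_ray:
  assumes "branch \<sigma>" shows "T.rayin nodes \<sigma>"
proof -
  have "inj \<sigma>" using branchD(4)[OF assms] by (intro injI) (metis add_left_cancel)
  then show ?thesis using branchD(1,2)[OF assms] unfolding T.rayin_def by auto
qed

end

section \<open>Displaying the topological ends\<close>

locale connected_graph = bidirected_graph G for G :: "'a pair_pre_digraph" +
  fixes z0 :: 'a
  assumes connd_G: "connd (pverts G)" and z0_in: "z0 \<in> pverts G"

sublocale connected_graph \<subseteq> rooted_graph "\<lambda>x y. (x, y) \<in> parcs G" "pverts G" z0
  by unfold_locales (use connd_G z0_in arc_in_verts in auto)

context connected_graph
begin

lemma branch_suffix:
  assumes "branch \<sigma>" "i \<le> j" shows "suffix (\<sigma> i) (\<sigma> j)"
  using assms(2)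
proof (induction rule: dec_induct)
  case (step n) then show ?case using branchD(2)[OF assms(1), of n] by (metis suffix_ConsI)
qed simp

lemma orients_towards_region:
  assumes s: "s \<in> nodes" and sub: "region s \<subseteq> side dtree part x y - separator part x y"
    and tail: "\<And>r. r \<in> \<epsilon> \<Longrightarrow> has_tail_in r (region s)"
  shows "orients_towards G dtree part \<epsilon> x y"
proof -
  obtain C where C: "C \<in> pre_digraph.sccs_verts (with_proj G \<restriction> (side dtree part x y - separator part x y))"
    "region s \<subseteq> C"
    using sccs_verts_superset[OF part_props(8,7)[OF s] sub] by blast
  then have "\<forall>r\<in>\<epsilon>. has_tail_in r C" using tail unfolding has_tail_in_def by blast
  then show ?thesis using C unfolding orients_towards_def by blast
qed

text \<open>One ray of \<open>\<omega>\<close> suffices: for each edge, the region of a late node on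
  it lies on the required side and off the separator.\<close>

lemma lives_in_tree_endI:
  assumes \<rho>: "branch (\<lambda>i. \<rho> (i + N))" "\<rho> \<in> \<omega>"
    and tails: "\<And>r i. r \<in> \<epsilon> \<Longrightarrow> has_tail_in r (region (\<rho> (i + N)))"
  shows "lives_in_tree_end G dtree part \<epsilon> \<omega>"
  unfolding lives_in_tree_end_def
proof (intro allI impI)
  fix x y assume a: "x \<rightarrow>\<^bsub>with_proj dtree\<^esub> y \<and> (\<forall>\<rho>\<in>\<omega>. has_tail_in \<rho> (tree_side dtree x y))"
  then obtain n where n: "\<forall>m\<ge>n. \<rho> m \<in> tree_side dtree x y" using \<rho>(2) by (auto simp: has_tail_in_def)
  have "(x, y) \<in> parcs dtree" using a by simp
  then show "orients_towards G dtree part \<epsilon> x y"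
  proof (cases rule: arc_cases)
    case (1 D c)
    have s: "\<rho> (n + N) \<in> nodes" "suffix (D # c) (\<rho> (n + N))"
      using n 1 by (auto simp: tree_side_up)
    show ?thesis
      by (rule orients_towards_region[OF s(1) _ tails])
        (use region_in_side[OF s(1) 1(1) s(2)] 1 in \<open>simp add: side_def tree_side_up separator_eq\<close>)
  next
    case (2 D c)
    \<comment> \<open>The index is large enough for the node to be longer than \<open>D # c\<close>,
      so it is not an ancestor of \<open>D # c\<close>.\<close>
    define i where "i = n + Suc (length (D # c))"
    have "\<rho> (i + N) \<in> tree_side dtree x y" using n by (simp add: i_def)
    then have s: "\<rho> (i + N) \<in> nodes" "\<not> suffix (D # c) (\<rho> (i + N))" using 2 by (auto simp: tree_side_down)
    have "length (\<rho> (i + N)) > length (D # c)" using branchD(4)[OF \<rho>(1), of i] by (simp add: i_def)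
    then have ns: "\<not> suffix (\<rho> (i + N)) (D # c)" using suffix_length_le[of "\<rho> (i + N)" "D # c"] by linarith
    show ?thesis
      by (rule orients_towards_region[OF s(1) _ tails])
        (use region_out_side[OF s(1) 2(1) s(2) ns] 2 in \<open>simp add: side_def tree_side_down separator_eq\<close>)
  qed
qed

text \<open>The edge from \<open>\<rho> (i + N)\<close> to its successor \<open>D # c\<close> is
  oriented upwards by \<open>\<epsilon>\<close>, and the upper side without the separator lies in
  \<open>D\<close>.\<close>

lemma lives_in_tree_endD:
  assumes b: "branch (\<lambda>i. \<rho> (i + N))" and \<rho>: "T.rayin nodes \<rho>"
    and lives: "lives_in_tree_end G dtree part \<epsilon> (T.ray_class \<rho>)" and r: "r \<in> \<epsilon>"
  shows "has_tail_in r (region (\<rho> (i + N)))"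
proof -
  define c where "c = \<rho> (i + N)"
  define D where "D = region (\<rho> (Suc i + N))"
  have Dc: "\<rho> (Suc i + N) = D # c" using branchD(2)[OF b, of i] by (simp add: D_def c_def)
  have n: "D # c \<in> nodes" using branchD(1)[OF b, of "Suc i"] Dc by simp
  let ?S = "{t \<in> nodes. suffix (D # c) t}"
  have "\<rho> m \<in> ?S" if "m \<ge> Suc i + N" for m
    using branch_suffix[OF b, of "Suc i" "m - N"] branchD(1)[OF b, of "m - N"] that Dc by simp
  then have tail: "has_tail_in \<rho> ?S" unfolding has_tail_in_def by blast
  \<comment> \<open>A finite neighbourhood in the tree lets the tail of \<open>\<rho>\<close> above
    \<open>D # c\<close> carry over to every ray of its end, as \<open>lives_in_tree_end\<close>
    quantifies over all of them.\<close>
  have "T.nb nodes ?S \<subseteq> {c}"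
    unfolding T.nb_def by (auto simp: suffix_Cons)
  then have fin: "finite (T.nb (pverts dtree) ?S)" using finite_subset by auto
  have "has_tail_in \<rho>' (tree_side dtree (D # c) c)" if "\<rho>' \<in> T.ray_class \<rho>" for \<rho>'
    using T.end_tails[OF _ tail fin that] \<rho> tree_side_up[OF n] by simp
  moreover have "(D # c, c) \<in> parcs dtree" using n by (auto simp: node_Cons)
  ultimately have "orients_towards G dtree part \<epsilon> (D # c) c"
    using lives unfolding lives_in_tree_end_def by simp
  then obtain C where C: "C \<in> pre_digraph.sccs_verts (with_proj G \<restriction> (side dtree part (D # c) c - separator part (D # c) c))"
    "has_tail_in r C" using r by (auto simp: orients_towards_def)
  have "side dtree part (D # c) c - separator part (D # c) c \<subseteq> D"
    using part_desc[of _ D c] by (auto simp: side_def tree_side_up[OF n] separator_eq[OF n])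
  then have "C \<subseteq> region c" using sccs_verts_sub[OF C(1)] child_props(1)[OF n] by blast
  then show ?thesis using C(2) unfolding has_tail_in_def c_def by blast
qed

text \<open>Once \<open>v\<close> has dropped out of the regions, a later region together with its
  finite neighbourhood misses \<open>v\<close>, and \<open>not_dominated\<close> applies.\<close>

lemma branch_end_undominated:
  assumes b: "branch \<sigma>" and tails: "\<And>r i. r \<in> \<epsilon> \<Longrightarrow> has_tail_in r (region (\<sigma> i))"
  shows "\<not> dominates_end G v \<epsilon>"
proof -
  obtain i where i: "v \<notin> region (\<sigma> i)" using branch_empty[OF b] by blast
  let ?D = "region (\<sigma> (Suc (Suc i)))"
  have "?D # \<sigma> (Suc i) \<in> nodes" using branchD(1,2)[OF b] by metis
  then have "finite (nb (pverts G) ?D)" by (rule child_props(9))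
  moreover have "?D \<subseteq> region (\<sigma> i)" "nb (pverts G) ?D \<subseteq> region (\<sigma> i)"
    using branch_dec[OF b, of "Suc i"] branch_dec(1)[OF b, of i] by auto
  ultimately show ?thesis using not_dominated[of ?D v \<epsilon>] i tails by blast
qed

lemma ray_class_tails:
  assumes "rayin (pverts G) r" "t \<in> nodes" "has_tail_in r (region t)" "s \<in> ray_class r"
  shows "has_tail_in s (region t)"
  using assms tail_equiv_region by (auto simp: ray_class_def)

text \<open>An end living in a tree end has tails in all regions of a branch. Rays with such tails
  are equivalent, which gives uniqueness, and the regions recede from every vertex, which excludes
  domination.\<close>

lemma displays_topological_ends: "displays G dtree part (topological_ends G)"
proof -
  have "(\<exists>!\<epsilon>. \<epsilon> \<in> ends G \<and> lives_in_tree_end G dtree part \<epsilon> \<omega>) \<and>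
      (\<forall>\<epsilon>\<in>ends G. lives_in_tree_end G dtree part \<epsilon> \<omega> \<longrightarrow> \<epsilon> \<in> topological_ends G)"
    if "\<omega> \<in> ends dtree" for \<omega>
  proof -
    obtain \<rho> where ray: "T.rayin (pverts dtree) \<rho>" and \<omega>: "\<omega> = T.ray_class \<rho>"
      using \<open>\<omega> \<in> ends dtree\<close> unfolding T.ends_eq by blast
    have \<rho>\<omega>: "\<rho> \<in> \<omega>" unfolding \<omega> by (rule T.ray_class_self[OF ray])
    note \<rho> = ray[unfolded dtree_simps(1)] \<omega>
    obtain N where b: "branch (\<lambda>i. \<rho> (i + N))" using ray_eventually_branch[OF \<rho>(1)] by blast
    obtain r where r: "rayin (pverts G) r" "\<And>i. has_tail_in r (region (\<rho> (i + N)))"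
      using branch_ray[OF b] by blast
    have D: "has_tail_in s (region (\<rho> (i + N)))" if "lives_in_tree_end G dtree part \<epsilon> \<omega>" "s \<in> \<epsilon>" for s \<epsilon> i
      using lives_in_tree_endD[OF b \<rho>(1)] that \<rho>(2) by blast
    have "lives_in_tree_end G dtree part (ray_class r) \<omega>"
      by (rule lives_in_tree_endI[OF b \<rho>\<omega>]) (rule ray_class_tails[OF r(1) branchD(1)[OF b] r(2)])
    moreover have "\<epsilon> = ray_class r" if \<epsilon>: "\<epsilon> \<in> ends G" "lives_in_tree_end G dtree part \<epsilon> \<omega>" for \<epsilon>
    proof -
      obtain s where s: "rayin (pverts G) s" "\<epsilon> = ray_class s" using \<epsilon>(1) by (auto simp: ends_eq)
      then have "has_tail_in s (region (\<rho> (i + N)))" for i using D[OF \<epsilon>(2)] ray_class_self by blast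
      then have "tail_equiv (pverts G) s r" using branch_rays_equiv[OF b _ r(2)] by blast
      then show ?thesis using ray_class_eqI s r by blast
    qed
    moreover have "\<epsilon> \<in> topological_ends G" if \<epsilon>: "\<epsilon> \<in> ends G" "lives_in_tree_end G dtree part \<epsilon> \<omega>" for \<epsilon>
      using branch_end_undominated[OF b D[OF \<epsilon>(2)]] \<epsilon>(1) by (auto simp: topological_ends_def)
    moreover have "ray_class r \<in> ends G" using r by (auto simp: ends_eq)
    ultimately show ?thesis by blast
  qed
  moreover have "\<exists>\<omega>\<in>ends dtree. lives_in_tree_end G dtree part \<epsilon> \<omega>" if \<epsilon>: "\<epsilon> \<in> topological_ends G" for \<epsilon>
  proof -
    obtain r where r: "rayin (pverts G) r" "\<epsilon> = ray_class r" using \<epsilon> by (auto simp: topological_ends_def ends_eq)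
    have "\<not> domin (pverts G) x r" if "x \<in> pverts G" for x
      using domin_imp_dominates_end[OF r(1)] ray_class_self[OF r(1)] \<epsilon> r(2) that
      by (auto simp: topological_ends_def)
    then obtain \<sigma> where \<sigma>: "branch \<sigma>" "\<And>i. has_tail_in r (region (\<sigma> i))"
      using undominated_ray_branch[OF r(1)] by blast
    have ray: "T.rayin (pverts dtree) \<sigma>" unfolding dtree_simps(1) by (rule branch_is_ray[OF \<sigma>(1)])
    have "lives_in_tree_end G dtree part \<epsilon> (T.ray_class \<sigma>)"
    proof (rule lives_in_tree_endI)
      show "branch (\<lambda>i. \<sigma> (i + 0))" using \<sigma>(1) by simp
      show "\<sigma> \<in> T.ray_class \<sigma>" by (rule T.ray_class_self[OF ray])
      show "has_tail_in s (region (\<sigma> (i + 0)))" if "s \<in> \<epsilon>" for s i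
        using ray_class_tails[OF r(1) branchD(1)[OF \<sigma>(1)] \<sigma>(2)] that r(2) by simp
    qed
    then show ?thesis using ray unfolding T.ends_eq by blast
  qed
  ultimately show ?thesis unfolding displays_def by blast
qed

end

theorem theorem4p2:
  fixes G :: "'a pair_pre_digraph"
  assumes "pair_bidirected_digraph G"
    and "connected (with_proj G)"
  shows "\<exists>(T :: 'a set list pair_pre_digraph) z V.
           rooted_tree_decomposition G T z V \<and>
           finite_adhesion T V \<and>
           (\<forall>t\<in>pverts T. connected (with_proj G \<restriction> V t)) \<and>
           upwards_disjoint_separators T z V \<and>
           displays G T V (topological_ends G)"
proof -
  interpret bidirected_graph G by (rule bidirected_graph.intro[OF assms(1)])
  have c: "pverts G \<noteq> {}" "connd (pverts G)" using assms(2) by (auto simp: connected_iff)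
  then obtain z0 where "z0 \<in> pverts G" by blast
  then interpret connected_graph G z0 by unfold_locales (use c in auto)
  have "rooted_tree_decomposition G dtree [] part"
    unfolding rooted_tree_decomposition_def tree_decomposition_def
    using dtree_tree dtree_decomposition on_path_part nodes.root by auto
  moreover have "\<forall>t\<in>pverts dtree. connected (with_proj G \<restriction> part t)"
    using part_props(3,4) by (auto simp: connected_induced_iff)
  ultimately show ?thesis
    using dtree_finite_adhesion dtree_upwards_disjoint displays_topological_ends by blast
qed

end
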